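(* Let $\Omega\subset\mathbb{R}^n$ be a Lebesgue measurable set and $f:\Omega\to\mathbb{R}$ a function. Assume that for almost every $x\in\Omega$, $$\liminf_{y\to x,\ y\in\Omega}\frac{f(y)-f(x)}{|y-x|}>-\infty.$$ Then for every $\varepsilon>0$ there exists $g\in C^1(\mathbb{R}^n)$ such that $\mathcal{L}^n(\{x\in\Omega: f(x)\neq g(x)\})\le\varepsilon$.
   Context: $\mathcal{L}^n$ denotes Lebesgue measure on $\mathbb{R}^n$ and $|\cdot|$ the Euclidean norm. *)

theory Defs
  imports "HOL-Analysis.Analysis"
begin

definition C1_UNIV :: "('a::euclidean_space \<Rightarrow> real) \<Rightarrow> bool" where
  "C1_UNIV g \<longleftrightarrow> (\<exists>D :: 'a \<Rightarrow> ('a \<Rightarrow>\<^sub>L real).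
      (\<forall>x. (g has_derivative blinfun_apply (D x)) (at x)) \<and> continuous_on UNIV D)"

definition lebesgue_outer :: "'a::euclidean_space set \<Rightarrow> ennreal" where
  "lebesgue_outer A = (INF B \<in> {B. B \<in> sets lebesgue \<and> A \<subseteq> B}. emeasure lebesgue B)"

end

theory Submission
  imports Defs
begin

text \<open>
  Where the lower derivate of \<open>f\<close> is not \<open>-\<infinity>\<close>, \<open>f(y) \<ge> f(x) - k |y - x|\<close> for \<open>y \<in> \<Omega>\<close> near \<open>x\<close> and some
  \<open>k\<close>. On the set \<open>E\<^sub>k\<close> where this holds at scale \<open>1/(k+1)\<close> the inequality can be used with \<open>x\<close> and \<open>y\<close>
  exchanged, so \<open>f\<close> is Lipschitz on bounded parts of \<open>E\<^sub>k\<close>, and the \<open>E\<^sub>k\<close> exhaust almost all of \<open>\<Omega>\<close>.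

  A Lipschitz function is approximated off a small set without Whitney's extension theorem: if \<open>f\<close> is
  \<open>L\<close>-Lipschitz and \<open>g\<close> is a mollification at a small scale, then almost everywhere approximability of \<open>f\<close> by
  affine functions makes \<open>f - g\<close> a \<open>L/2\<close>-Lipschitz function off a small set. Extending the remainder (McShane)
  and iterating writes \<open>f\<close> off a small set as a series of \<open>C\<^sup>1\<close> functions with geometrically decaying
  derivatives. The \<open>C\<^sup>1\<close> functions obtained on the shells \<open>m \<le> |x|\<^sup>2 < m + 1\<close> are glued by cutoffs.
\<close>

section \<open>Differentiability of Lipschitz functions on the line\<close>

text \<open>Halving a Lipschitz constant takes less than differentiability: an affine approximation
  with one fixed error \<open>\<eta>\<close> proportional to \<open>L\<close> is enough. At fixed
  accuracy the coefficient vector can be rounded to rational coordinates, so the sets of good points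
  are countable unions of closed sets. The hard point of Rademacher's theorem, that directional
  derivatives are linear in the direction, is replaced by a density argument on these closed sets;
  only derivatives along axis-parallel lines are used.

  The remainder after a mollification is controlled on a subset only. Its extension must keep both
  the halved constant and the support in a fixed ball, or the geometric decay would be lost; hence
  it is clamped and not multiplied by a cutoff. As \<open>f\<close> is not assumed measurable, all
  exceptional sets are enclosed in measurable sets of controlled measure.\<close>

lemma Vitali_measure_bound:
  fixes a :: "'i \<Rightarrow> 'n::euclidean_space" and V :: "'i \<Rightarrow> 'm::euclidean_space set"
  assumes pos: "\<And>i. i \<in> K \<Longrightarrow> 0 < r i"
    and fine: "\<And>x d. x \<in> S \<Longrightarrow> 0 < d \<Longrightarrow> \<exists>i\<in>K. x \<in> cball (a i) (r i) \<and> r i < d"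
    and U: "U \<in> lmeasurable" "\<And>i. i \<in> K \<Longrightarrow> cball (a i) (r i) \<subseteq> U"
    and V: "\<And>i. i \<in> K \<Longrightarrow> V i \<in> lmeasurable"
    and le: "\<And>i. i \<in> K \<Longrightarrow> measure lebesgue (V i) \<le> c * measure lebesgue (cball (a i) (r i))"
    and "0 \<le> c"
  obtains C where "C \<subseteq> K" "negligible (S - (\<Union>i\<in>C. cball (a i) (r i)))"
    "(\<Union>i\<in>C. V i) \<in> lmeasurable" "measure lebesgue (\<Union>i\<in>C. V i) \<le> c * measure lebesgue U"
proof -
  let ?B = "\<lambda>i. cball (a i) (r i)"
  have fine': "\<exists>i. i \<in> K \<and> x \<in> ?B i \<and> r i < d" if "x \<in> S" "0 < d" for x d
    using fine that by blast
  \<comment> \<open>The selected balls are disjoint and lie in \<open>U\<close>, so their measures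
    add up to at most that of \<open>U\<close>. The sets \<open>V i\<close> need only be small
    relative to their balls: they may overlap and may live in another space.\<close>
  obtain C where C: "countable C" "C \<subseteq> K" "pairwise (\<lambda>i j. disjnt (?B i) (?B j)) C"
      "negligible (S - (\<Union>i \<in> C. ?B i))"
    by (rule Vitali_covering_theorem_cballs [OF pos fine'])
  have bound: "measure lebesgue (\<Union>(V ` I)) \<le> c * measure lebesgue U"
    if I: "I \<subseteq> C" "finite I" for I
  proof -
    have "measure lebesgue (\<Union>(V ` I)) \<le> (\<Sum>i\<in>I. measure lebesgue (V i))"
      using I C V by (intro measure_UNION_le) (auto intro!: fmeasurableD)
    also have "\<dots> \<le> (\<Sum>i\<in>I. c * measure lebesgue (?B i))"
      using I C by (intro sum_mono le) auto
    also have "\<dots> = c * measure lebesgue (\<Union>i\<in>I. ?B i)"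
      using I C(3) by (subst measure_UNION') (auto simp: sum_distrib_left elim: pairwise_mono)
    also have "\<dots> \<le> c * measure lebesgue U"
      using I C U \<open>0 \<le> c\<close> by (intro mult_left_mono measure_mono_fmeasurable) (auto intro!: borel_closed)
    finally show ?thesis .
  qed
  show ?thesis
  proof
    show "(\<Union>i\<in>C. V i) \<in> lmeasurable"
      using C V by (intro fmeasurable_UN_bound [OF \<open>countable C\<close> _ bound]) auto
    show "measure lebesgue (\<Union>i\<in>C. V i) \<le> c * measure lebesgue U"
      using C V by (intro measure_UN_bound [OF \<open>countable C\<close> _ bound]) auto
  qed (use C in auto)
qed

lemma lmeasurable_outer_open_measure:
  assumes S: "S \<in> lmeasurable" and "e > 0"
  obtains T where "open T" "S \<subseteq> T" "T \<in> lmeasurable" "measure lebesgue T < measure lebesgue S + e"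
proof -
  obtain T where T: "open T" "S \<subseteq> T" "(T - S) \<in> lmeasurable" "emeasure lebesgue (T - S) < ennreal e"
    using sets_lebesgue_outer_open [OF fmeasurableD[OF S] \<open>e > 0\<close>] by blast
  have "T = S \<union> (T - S)" using T by auto
  then have Tm: "T \<in> lmeasurable" using S T by (metis fmeasurable.Un)
  have "measure lebesgue (T - S) < e"
    using T \<open>e > 0\<close> by (simp add: emeasure_eq_measure2 fmeasurableD2 ennreal_less_iff)
  moreover have "measure lebesgue T = measure lebesgue S + measure lebesgue (T - S)"
    using measurable_measure_Diff [OF Tm fmeasurableD[OF S]] T by simp
  ultimately show ?thesis using that T Tm by simp
qed

text \<open>A point \<open>x\<close> and a nearby \<open>y\<close> with small difference quotient
  span a short interval; its image under the monotone \<open>F\<close> lies between the values at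
  the ends, so its length grows at most by the factor \<open>p\<close>. Such intervals cover
  \<open>A\<close> finely, and the Lipschitz bound makes the image of the uncovered part
  negligible.\<close>

lemma measure_image_le_lower_derivate:
  fixes F :: "real \<Rightarrow> real"
  assumes mono: "mono F" and lip: "C-lipschitz_on UNIV F"
    and A: "A \<in> lmeasurable" "F ` A \<in> lmeasurable" and "0 \<le> p"
    and deriv: "\<And>x d. x \<in> A \<Longrightarrow> 0 < d \<Longrightarrow> \<exists>y. 0 < \<bar>y - x\<bar> \<and> \<bar>y - x\<bar> < d \<and> \<bar>F y - F x\<bar> \<le> p * \<bar>y - x\<bar>"
  shows "measure lebesgue (F ` A) \<le> p * measure lebesgue A"
proof (rule field_le_epsilon)
  fix e :: real assume "0 < e"
  define e' where "e' = e / (p + 1)"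
  have e': "e' > 0" "p * e' \<le> e" using \<open>0 < e\<close> \<open>0 \<le> p\<close> by (auto simp: e'_def field_simps)
  obtain U where U: "open U" "A \<subseteq> U" "U \<in> lmeasurable" "measure lebesgue U < measure lebesgue A + e'"
    using lmeasurable_outer_open_measure [OF A(1) \<open>e' > 0\<close>] by blast
  \<comment> \<open>An index is a pair \<open>(x, y)\<close> with \<open>y\<close> on either side of
    \<open>x\<close>. Here \<open>x\<close> is an endpoint of the interval, not its midpoint; the
    covering theorem only asks that it lie in the ball.\<close>
  define lo where "lo = (\<lambda>(x::real, y). min x y)"
  define hi where "hi = (\<lambda>(x::real, y). max x y)"
  define a where "a = (\<lambda>i. (lo i + hi i) / 2)"
  define r where "r = (\<lambda>i. (hi i - lo i) / 2)"
  define K where "K = {i. lo i < hi i \<and> cball (a i) (r i) \<subseteq> U \<and> F (hi i) - F (lo i) \<le> p * (hi i - lo i)}"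
  have cb: "cball (a i) (r i) = {lo i..hi i}" for i
    by (auto simp: a_def r_def cball_eq_atLeastAtMost field_simps)
  have lh: "lo i \<le> hi i" for i by (auto simp: lo_def hi_def split: prod.splits)
  have fine: "\<exists>i\<in>K. x \<in> cball (a i) (r i) \<and> r i < d" if x: "x \<in> A" and "0 < d" for x d
  proof -
    obtain k where k: "k > 0" "ball x k \<subseteq> U" using U x by (meson openE subsetD)
    obtain y where y: "0 < \<bar>y - x\<bar>" "\<bar>y - x\<bar> < min d k" "\<bar>F y - F x\<bar> \<le> p * \<bar>y - x\<bar>"
      using deriv [OF x, of "min d k"] \<open>0 < d\<close> k by auto
    have "{lo (x,y)..hi (x,y)} \<subseteq> ball x k"
      using y by (auto simp: lo_def hi_def dist_real_def)
    moreover have "F (hi (x,y)) - F (lo (x,y)) \<le> \<bar>F y - F x\<bar>" "hi (x,y) - lo (x,y) = \<bar>y - x\<bar>"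
      by (auto simp: lo_def hi_def min_def max_def)
    ultimately have "(x,y) \<in> K" using y k unfolding K_def cb by auto
    moreover have "x \<in> cball (a (x,y)) (r (x,y))" by (auto simp: cb lo_def hi_def)
    moreover have "r (x,y) < d" using y by (auto simp: r_def lo_def hi_def)
    ultimately show ?thesis by blast
  qed
  have pos: "0 < r i" if "i \<in> K" for i using that by (auto simp: K_def r_def)
  have sub: "cball (a i) (r i) \<subseteq> U" if "i \<in> K" for i using that by (auto simp: K_def)
  have Vle: "measure lebesgue (cbox (F (lo i)) (F (hi i))) \<le> p * measure lebesgue (cball (a i) (r i))" if "i \<in> K" for i
    using that lh[of i] monoD[OF mono lh[of i]] unfolding cb K_def by auto
  obtain D where D: "D \<subseteq> K" "negligible (A - (\<Union>i\<in>D. cball (a i) (r i)))"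
    "(\<Union>i\<in>D. cbox (F (lo i)) (F (hi i))) \<in> lmeasurable"
    "measure lebesgue (\<Union>i\<in>D. cbox (F (lo i)) (F (hi i))) \<le> p * measure lebesgue U"
    by (rule Vitali_measure_bound [OF pos fine U(3) sub lmeasurable_cbox Vle \<open>0 \<le> p\<close>])
  let ?N = "F ` (A - (\<Union>i\<in>D. cball (a i) (r i)))"
  have neg: "negligible ?N"
    by (rule negligible_locally_Lipschitz_image [OF _ D(2)])
       (use lipschitz_onD[OF lip] in \<open>auto intro!: exI[of _ UNIV] exI[of _ C] simp: dist_norm\<close>)
  have "F ` A \<subseteq> (\<Union>i\<in>D. cbox (F (lo i)) (F (hi i))) \<union> ?N"
  proof
    fix z assume "z \<in> F ` A"
    then obtain x where x: "x \<in> A" "z = F x" by blast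
    show "z \<in> (\<Union>i\<in>D. cbox (F (lo i)) (F (hi i))) \<union> ?N"
    proof (cases "\<exists>i\<in>D. x \<in> cball (a i) (r i)")
      case True
      then obtain i where "i \<in> D" "lo i \<le> x" "x \<le> hi i" by (auto simp: cb)
      then show ?thesis using x mono by (auto dest: monoD)
    qed (use x in auto)
  qed
  then have "measure lebesgue (F ` A) \<le> measure lebesgue ((\<Union>i\<in>D. cbox (F (lo i)) (F (hi i))) \<union> ?N)"
    using A D(3) neg by (intro measure_mono_fmeasurable fmeasurable.Un) (auto simp: negligible_imp_measurable)
  also have "\<dots> \<le> measure lebesgue (\<Union>i\<in>D. cbox (F (lo i)) (F (hi i))) + measure lebesgue ?N"
    using D(3) neg by (intro measure_Un_le) (auto simp: negligible_imp_measurable fmeasurableD)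
  also have "\<dots> \<le> p * measure lebesgue U" using D(4) neg by (simp add: negligible_imp_measure0)
  also have "\<dots> \<le> p * (measure lebesgue A + e')" using U \<open>0 \<le> p\<close> by (intro mult_left_mono) auto
  also have "\<dots> \<le> p * measure lebesgue A + e" using e' by (simp add: algebra_simps)
  finally show "measure lebesgue (F ` A) \<le> p * measure lebesgue A + e" .
qed

lemma negligible_Int_cball:
  fixes S :: "'a::euclidean_space set"
  assumes "\<And>n. negligible (S \<inter> cball 0 (real n))"
  shows "negligible S"
proof -
  have "S = (\<Union>n. S \<inter> cball 0 (real n))"
    using real_arch_simple by auto
  then show ?thesis using assms negligible_Union_nat by metis
qed

text \<open>The two bounds make \<open>F\<close> a homeomorphism of the line whose inverse
  \<open>G\<close> is 1-Lipschitz. A difference quotient of \<open>F\<close> above \<open>q\<close>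
  is one of \<open>G\<close> below \<open>1/q\<close>, so the estimate for small quotients, applied
  to \<open>F\<close> and to \<open>G\<close>, treats both conditions.\<close>

lemma negligible_derivate_gap:
  fixes F :: "real \<Rightarrow> real"
  assumes low: "\<And>x y. x < y \<Longrightarrow> y - x \<le> F y - F x"
    and upp: "\<And>x y. x < y \<Longrightarrow> F y - F x \<le> C * (y - x)"
    and "0 < p" "p < q"
  shows "negligible {t. \<forall>m. (\<exists>h. h \<noteq> 0 \<and> \<bar>h\<bar> < inverse (Suc m) \<and> (F (t + h) - F t) / h < p) \<and>
                          (\<exists>h. h \<noteq> 0 \<and> \<bar>h\<bar> < inverse (Suc m) \<and> q < (F (t + h) - F t) / h)}"
    (is "negligible ?S")
proof -
  have mono: "mono F" by (rule monoI) (metis diff_ge_0_iff_ge low nle_le order_le_less order_trans)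
  have low': "\<bar>x - y\<bar> \<le> \<bar>F x - F y\<bar>" for x y
    using low[of x y] low[of y x] by (cases x y rule: linorder_cases) auto
  have upp': "\<bar>F x - F y\<bar> \<le> C * \<bar>x - y\<bar>" for x y
    using upp[of x y] upp[of y x] low[of x y] low[of y x] by (cases x y rule: linorder_cases) auto
  have lip: "\<bar>C\<bar>-lipschitz_on UNIV F"
    by (rule lipschitz_onI) (auto simp: dist_real_def intro!: order_trans[OF upp'] mult_right_mono)
  have cont: "continuous_on UNIV F" using lip by (rule lipschitz_on_continuous_on)
  have inj: "inj F" by (rule injI) (metis low' abs_le_zero_iff diff_self abs_zero eq_iff_diff_eq_0)
  have "\<exists>x. F x = z" for z
  proof -
    define b where "b = \<bar>z\<bar> + \<bar>F 0\<bar> + 1"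
    have b: "0 < b" "\<bar>z\<bar> + \<bar>F 0\<bar> < b" by (auto simp: b_def)
    have "b \<le> F 0 - F (-b)" "b \<le> F b - F 0" using low[of "-b" 0] low[of 0 b] b by auto
    then have "F (-b) \<le> z" "z \<le> F b" using b by linarith+
    then show ?thesis
      using IVT'[of F "-b" z b] continuous_on_subset[OF cont] b by auto
  qed
  then have surj: "surj F" by (metis surjI)
  define G where "G = inv F"
  have GF: "G (F x) = x" "F (G z) = z" for x z
    using inj surj by (auto simp: G_def surj_f_inv_f)
  have Glip: "1-lipschitz_on UNIV G"
    by (rule lipschitz_onI) (use low'[of "G x" "G y" for x y] in \<open>auto simp: dist_real_def GF\<close>)
  have Gmono: "mono G"
    by (rule monoI) (metis GF mono linorder_linear monoD order_antisym)
  have Gcont: "continuous_on UNIV G" using Glip by (rule lipschitz_on_continuous_on)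
  have qeq: "(\<exists>h. h \<noteq> 0 \<and> \<bar>h\<bar> < d \<and> P ((F (t + h) - F t) / h))
      \<longleftrightarrow> (\<exists>y. y \<noteq> t \<and> \<bar>y - t\<bar> < d \<and> P ((F y - F t) / (y - t)))" for P d t
  proof safe
    fix h assume "h \<noteq> 0" "\<bar>h\<bar> < d" "P ((F (t + h) - F t) / h)"
    then show "\<exists>y. y \<noteq> t \<and> \<bar>y - t\<bar> < d \<and> P ((F y - F t) / (y - t))"
      by (intro exI[of _ "t + h"]) auto
  next
    fix y assume "y \<noteq> t" "\<bar>y - t\<bar> < d" "P ((F y - F t) / (y - t))"
    then show "\<exists>h. h \<noteq> 0 \<and> \<bar>h\<bar> < d \<and> P ((F (t + h) - F t) / h)"
      by (intro exI[of _ "y - t"]) auto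
  qed
  have S_borel: "?S \<in> sets borel"
  proof -
    \<comment> \<open>For a fixed nonzero increment the quotient is continuous in \<open>t\<close>,
      so even an uncountable union over increments is open, and \<open>?S\<close> is a countable
      intersection of open sets.\<close>
    have op: "open (\<Union>h\<in>H. {t. (F (t + h) - F t) / h < p})" "open (\<Union>h\<in>H. {t. q < (F (t + h) - F t) / h})"
      if "0 \<notin> H" for H
      using that by (auto intro!: open_UN open_Collect_less continuous_intros continuous_on_compose2[OF cont])
    have eq: "?S = (\<Inter>m. (\<Union>h\<in>{h. h \<noteq> 0 \<and> \<bar>h\<bar> < inverse (Suc m)}. {t. (F (t + h) - F t) / h < p}) \<inter>
                     (\<Union>h\<in>{h. h \<noteq> 0 \<and> \<bar>h\<bar> < inverse (Suc m)}. {t. q < (F (t + h) - F t) / h}))"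
      by auto
    show ?thesis unfolding eq by (rule sets.countable_INT'') (use op in \<open>auto intro!: sets.Int borel_open\<close>)
  qed
  have "negligible (?S \<inter> cball 0 (real n))" for n
  proof -
    let ?A = "?S \<inter> cball 0 (real n)"
    have Ab: "?A \<in> sets borel" using S_borel by auto
    have A: "?A \<in> lmeasurable"
      by (rule bounded_set_imp_lmeasurable) (use Ab in \<open>auto intro!: bounded_Int\<close>)
    have "F ` A = G -` A \<inter> space borel" for A
    proof safe
      fix z assume "G z \<in> A"
      then show "z \<in> F ` A" using GF(2)[of z] by (metis image_eqI)
    qed (auto simp: GF)
    then have FA: "F ` ?A = G -` ?A \<inter> space borel" .
    have FAb: "F ` ?A \<in> sets borel"
      unfolding FA using Ab borel_measurable_continuous_onI[OF Gcont] by (rule measurable_sets[rotated])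
    have FAm: "F ` ?A \<in> lmeasurable"
    proof (rule bounded_set_imp_lmeasurable)
      have "bounded (F ` cball 0 (real n))"
        by (intro compact_imp_bounded compact_continuous_image continuous_on_subset[OF cont]) auto
      then show "bounded (F ` ?A)" by (rule bounded_subset) auto
    qed (use FAb in auto)
    have small: "\<exists>m. inverse (Suc m) < d" if "d > 0" for d :: real
      using reals_Archimedean[OF that] by auto
    \<comment> \<open>Both \<open>|F(A)| \<le> p |A|\<close> and, by the same bound for the inverse of \<open>F\<close>, \<open>|A| \<le> |F(A)| / q\<close>.\<close>
    have 1: "measure lebesgue (F ` ?A) \<le> p * measure lebesgue ?A"
    proof (rule measure_image_le_lower_derivate[OF mono lip A FAm])
      fix x d :: real assume x: "x \<in> ?A" "0 < d"
      obtain m where m: "inverse (Suc m) < d" using small x by blast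
      have "\<exists>y. y \<noteq> x \<and> \<bar>y - x\<bar> < inverse (Suc m) \<and> (F y - F x) / (y - x) < p"
        using x by (subst qeq[symmetric]) auto
      then obtain y where y: "y \<noteq> x" "\<bar>y - x\<bar> < d" "(F y - F x) / (y - x) < p" using m by force
      then have "\<bar>F y - F x\<bar> \<le> p * \<bar>y - x\<bar>"
        using low[of x y] low[of y x] by (cases x y rule: linorder_cases) (auto simp: field_simps)
      then show "\<exists>y. 0 < \<bar>y - x\<bar> \<and> \<bar>y - x\<bar> < d \<and> \<bar>F y - F x\<bar> \<le> p * \<bar>y - x\<bar>"
        using y by auto
    qed (use \<open>0 < p\<close> in auto)
    have GFA: "G ` F ` ?A = ?A" by (simp add: image_image GF)
    have "measure lebesgue (G ` F ` ?A) \<le> (1/q) * measure lebesgue (F ` ?A)"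
    proof (rule measure_image_le_lower_derivate[OF Gmono Glip FAm])
      show "G ` F ` ?A \<in> lmeasurable" using A GFA by simp
      fix z d :: real assume z: "z \<in> F ` ?A" "0 < d"
      then obtain x where x: "x \<in> ?A" "z = F x" by blast
      have "0 < d / (\<bar>C\<bar> + 1)" using z by simp
      then obtain m where m: "inverse (Suc m) < d / (\<bar>C\<bar> + 1)" using small by blast
      have "\<exists>y. y \<noteq> x \<and> \<bar>y - x\<bar> < inverse (Suc m) \<and> q < (F y - F x) / (y - x)"
        using x by (subst qeq[symmetric]) auto
      then obtain y where y: "y \<noteq> x" "\<bar>y - x\<bar> < d / (\<bar>C\<bar> + 1)" "q < (F y - F x) / (y - x)" using m by force
      have "\<bar>F y - F x\<bar> \<le> \<bar>C\<bar> * \<bar>y - x\<bar>" by (rule order_trans[OF upp']) (simp add: mult_right_mono)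
      also have "\<dots> \<le> (\<bar>C\<bar> + 1) * \<bar>y - x\<bar>" by (simp add: mult_right_mono)
      also have "\<dots> < d" using y by (simp add: field_simps)
      finally have "\<bar>F y - F x\<bar> < d" .
      moreover have "q * \<bar>y - x\<bar> \<le> \<bar>F y - F x\<bar>"
        using y low[of x y] low[of y x] by (cases x y rule: linorder_cases) (auto simp: field_simps)
      then have "\<bar>y - x\<bar> \<le> (1/q) * \<bar>F y - F x\<bar>"
        using \<open>0 < p\<close> \<open>p < q\<close> by (simp add: field_simps)
      moreover have "0 < \<bar>F y - F x\<bar>" using low'[of x y] low'[of y x] y by auto
      ultimately show "\<exists>y. 0 < \<bar>y - z\<bar> \<and> \<bar>y - z\<bar> < d \<and> \<bar>G y - G z\<bar> \<le> (1/q) * \<bar>y - z\<bar>"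
        unfolding x by (intro exI[of _ "F y"]) (auto simp: GF)
    qed (use \<open>0 < p\<close> \<open>p < q\<close> in auto)
    also have "\<dots> \<le> (1/q) * (p * measure lebesgue ?A)"
      using 1 \<open>0 < p\<close> \<open>p < q\<close> by (intro mult_left_mono) auto
    finally have "q * measure lebesgue ?A \<le> p * measure lebesgue ?A"
      unfolding GFA using \<open>0 < p\<close> \<open>p < q\<close> by (simp add: field_simps)
    then have "measure lebesgue ?A \<le> 0"
      using \<open>p < q\<close> by (simp add: mult_le_cancel_right)
    then show ?thesis using A by (simp add: negligible_iff_measure measure_le_0_iff)
  qed
  then show ?thesis by (rule negligible_Int_cball)
qed

text \<open>Where the quotients do not converge, two rationals separate their lower and upper
  limits, so the exceptional set lies in a countable union of sets \<open>A p q\<close>. The added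
  slope \<open>L + 1\<close> exceeds the steepest descent of \<open>f\<close> by 1: all quotients
  are at least 1, and \<open>p\<close> can be taken positive.\<close>

lemma lipschitz_real_ae_differentiable:
  fixes f :: "real \<Rightarrow> real"
  assumes lip: "L-lipschitz_on UNIV f"
  shows "negligible {t. \<not> (\<exists>l. ((\<lambda>h. (f (t + h) - f t) / h) \<longlongrightarrow> l) (at 0))}"
proof -
  \<comment> \<open>Adding a linear term makes the function bilipschitz without affecting differentiability.\<close>
  define F where "F = (\<lambda>t. f t + (L + 1) * t)"
  have L: "0 \<le> L" using lip by (rule lipschitz_on_nonneg)
  have f: "\<bar>f x - f y\<bar> \<le> L * \<bar>x - y\<bar>" for x y
    using lipschitz_onD[OF lip, of x y] by (simp add: dist_real_def)
  have low: "y - x \<le> F y - F x" if "x < y" for x y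
    using f[of y x] that by (simp add: F_def algebra_simps)
  have upp: "F y - F x \<le> (2 * L + 1) * (y - x)" if "x < y" for x y
    using f[of y x] that by (simp add: F_def algebra_simps)
  define Q where "Q = (\<lambda>t h. (F (t + h) - F t) / h)"
  have Q: "1 \<le> Q t h" "Q t h \<le> 2 * L + 1" if "h \<noteq> 0" for t h
    using low[of t "t+h"] low[of "t+h" t] upp[of t "t+h"] upp[of "t+h" t] that
    by (cases "h > 0"; simp add: Q_def field_simps)+
  define A where "A = (\<lambda>p q. {t. \<forall>m. (\<exists>h. h \<noteq> 0 \<and> \<bar>h\<bar> < inverse (Suc m) \<and> Q t h < p) \<and>
                          (\<exists>h. h \<noteq> 0 \<and> \<bar>h\<bar> < inverse (Suc m) \<and> q < Q t h)})"
  have neg: "negligible (\<Union>(p,q)\<in>{(p,q). p \<in> \<rat> \<and> q \<in> \<rat> \<and> 0 < p \<and> p < q}. A p q)"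
  proof (rule negligible_countable_Union, goal_cases)
    case 1
    have "countable ((\<rat> :: real set) \<times> (\<rat> :: real set))" by (simp add: countable_rat)
    then have "countable {(p::real,q::real). p \<in> \<rat> \<and> q \<in> \<rat> \<and> 0 < p \<and> p < q}"
      by (rule countable_subset[rotated]) auto
    then show ?case by (rule countable_image)
  next
    case (2 S)
    then show ?case using negligible_derivate_gap[OF low upp] by (auto simp: A_def Q_def)
  qed
  have freq: "\<exists>h. h \<noteq> 0 \<and> \<bar>h\<bar> < d \<and> P h" if "\<exists>\<^sub>F h in at 0. P h" "0 < d" for P and d :: real
    using that unfolding frequently_at by (auto simp: dist_real_def)
  have "t \<in> (\<Union>(p,q)\<in>{(p,q). p \<in> \<rat> \<and> q \<in> \<rat> \<and> 0 < p \<and> p < q}. A p q)"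
    if t: "\<not> (\<exists>l. ((\<lambda>h. (f (t + h) - f t) / h) \<longlongrightarrow> l) (at 0))" for t
  proof -
    define a where "a = Liminf (at 0) (\<lambda>h. ereal (Q t h))"
    define b where "b = Limsup (at 0) (\<lambda>h. ereal (Q t h))"
    have ev: "\<forall>\<^sub>F h in at 0. 1 \<le> Q t h \<and> Q t h \<le> 2 * L + 1"
      using Q by (auto simp: eventually_at intro!: exI[of _ 1])
    have a1: "1 \<le> a" unfolding a_def
      by (rule Liminf_bounded) (use ev in eventually_elim, simp)
    have b1: "b \<le> ereal (2 * L + 1)" unfolding b_def
      by (rule Limsup_bounded) (use ev in eventually_elim, simp)
    have ab: "a \<le> b" unfolding a_def b_def by (rule Liminf_le_Limsup) simp
    have "a \<noteq> b"
    proof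
      assume eq: "a = b"
      obtain l where l: "a = ereal l" using a1 b1 ab by (cases a) (auto simp: eq)
      have "((\<lambda>h. ereal (Q t h)) \<longlongrightarrow> a) (at 0)"
        by (rule Liminf_eq_Limsup) (use eq in \<open>auto simp: a_def b_def\<close>)
      then have "(Q t \<longlongrightarrow> l) (at 0)" by (simp add: l)
      then have "((\<lambda>h. Q t h - (L + 1)) \<longlongrightarrow> l - (L + 1)) (at 0)" by (intro tendsto_intros)
      moreover have "\<forall>\<^sub>F h in at 0. Q t h - (L + 1) = (f (t + h) - f t) / h"
        by (auto simp: eventually_at Q_def F_def field_simps intro!: exI[of _ 1])
      ultimately have "((\<lambda>h. (f (t + h) - f t) / h) \<longlongrightarrow> l - (L + 1)) (at 0)"
        by (rule Lim_transform_eventually)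
      then show False using t by blast
    qed
    then have "a < b" using ab by simp
    \<comment> \<open>Rational density is used between reals, so three reals are put between the
      extended limits: \<open>p\<close> lies between \<open>a'\<close> and \<open>b'\<close>,
      \<open>q\<close> between \<open>b'\<close> and \<open>c'\<close>, whence
      \<open>p < q\<close>.\<close>
    then obtain a' where a': "a < ereal a'" "ereal a' < b" using ereal_dense2 by blast
    obtain b' where b': "ereal a' < ereal b'" "ereal b' < b" using a'(2) ereal_dense2 by blast
    obtain c' where c': "ereal b' < ereal c'" "ereal c' < b" using b'(2) ereal_dense2 by blast
    obtain p where p: "p \<in> \<rat>" "a' < p" "p < b'" using Rats_dense_in_real b' by auto
    obtain q where q: "q \<in> \<rat>" "b' < q" "q < c'" using Rats_dense_in_real c' by auto
    have "1 < ereal a'" using a1 a' by order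
    then have p0: "0 < p" using p by auto
    have "\<exists>\<^sub>F h in at 0. Q t h < p"
    proof (rule ccontr)
      assume "\<not> ?thesis"
      then have "\<forall>\<^sub>F h in at 0. ereal p \<le> ereal (Q t h)" by (simp add: not_frequently not_less)
      then have "ereal p \<le> a" unfolding a_def by (rule Liminf_bounded)
      then show False using a' p by (metis ereal_less_eq(3) less_eq_ereal_def not_less order_less_trans)
    qed
    moreover have "\<exists>\<^sub>F h in at 0. q < Q t h"
    proof (rule ccontr)
      assume "\<not> ?thesis"
      then have "\<forall>\<^sub>F h in at 0. ereal (Q t h) \<le> ereal q" by (simp add: not_frequently not_less)
      then have "b \<le> ereal q" unfolding b_def by (rule Limsup_bounded)
      then show False using c' q by (metis ereal_less_eq(3) less_eq_ereal_def not_less order_less_trans)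
    qed
    ultimately have "t \<in> A p q" unfolding A_def by (auto intro!: freq)
    then show ?thesis using p q p0 by fastforce
  qed
  then show ?thesis by (intro negligible_subset[OF neg]) blast
qed

section \<open>Affine approximation of Lipschitz functions almost everywhere\<close>

lemma negligible_if_negligible_on_lines:
  fixes N :: "'a::euclidean_space set" and v :: 'a
  assumes N: "N \<in> sets borel" and lines: "\<And>x. negligible {t::real. x + t *\<^sub>R v \<in> N}"
  shows "negligible N"
proof -
  \<comment> \<open>Tonelli on \<open>(x, t)\<close> with \<open>t \<in> [0, 1]\<close>: all translates \<open>N - t v\<close> have the measure of \<open>N\<close>,
    so no coordinates adapted to \<open>v\<close> are needed.\<close>
  have meas: "case_prod (\<lambda>x t. indicator N (x + t *\<^sub>R v) * indicator {0..1} t :: ennreal) \<in> borel_measurable (lborel \<Otimes>\<^sub>M (lborel :: real measure))"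
    (is "case_prod ?h \<in> _")
  proof -
    have [measurable]: "N \<in> sets borel" by fact
    have [measurable]: "(\<lambda>(x::'a, t::real). x + t *\<^sub>R v) \<in> borel_measurable (lborel \<Otimes>\<^sub>M (lborel :: real measure))"
      unfolding split_beta by measurable
    have "(\<lambda>p. indicator N (case_prod (\<lambda>x t. x + t *\<^sub>R v) p) * indicator {0..1} (snd p) :: ennreal)
      \<in> borel_measurable (lborel \<Otimes>\<^sub>M (lborel :: real measure))"
      by measurable
    then show ?thesis by (simp add: split_beta')
  qed
  have 0: "(\<integral>\<^sup>+t. ?h x t \<partial>lborel) = 0" for x
  proof -
    have B: "{t. x + t *\<^sub>R v \<in> N} \<in> sets borel"
      using measurable_sets[of "\<lambda>t. x + t *\<^sub>R v" borel borel N] N by (simp add: vimage_def)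
    then have "emeasure lborel {t. x + t *\<^sub>R v \<in> N} = 0"
      using lines[of x] by (simp add: negligible_iff_emeasure0)
    moreover have "(\<integral>\<^sup>+t. ?h x t \<partial>lborel) \<le> (\<integral>\<^sup>+t. indicator {t. x + t *\<^sub>R v \<in> N} t \<partial>lborel)"
      by (intro nn_integral_mono) (auto simp: indicator_def)
    ultimately show ?thesis using B by simp
  qed
  have "(\<integral>\<^sup>+x. ?h x t \<partial>lborel) = emeasure lborel N * indicator {0..1} t" for t
  proof -
    have "emeasure lborel N = (\<integral>\<^sup>+x. indicator N x \<partial>distr lborel borel ((+) (t *\<^sub>R v)))"
      using N by (simp add: lborel_distr_plus)
    also have "\<dots> = (\<integral>\<^sup>+x. indicator N (t *\<^sub>R v + x) \<partial>lborel)"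
      using N by (subst nn_integral_distr) auto
    finally show ?thesis
      using N by (simp add: add.commute nn_integral_multc)
  qed
  then have "(\<integral>\<^sup>+t. \<integral>\<^sup>+x. ?h x t \<partial>lborel \<partial>lborel) = emeasure lborel N"
    by (simp add: nn_integral_cmult)
  moreover have "(\<integral>\<^sup>+t. \<integral>\<^sup>+x. ?h x t \<partial>lborel \<partial>lborel) = (\<integral>\<^sup>+x. \<integral>\<^sup>+t. ?h x t \<partial>lborel \<partial>lborel)"
    by (rule lborel_pair.Fubini'[OF meas])
  ultimately show ?thesis
    using N 0 by (simp add: negligible_iff_emeasure0)
qed

text \<open>Each line in direction \<open>v\<close> carries a Lipschitz function of one variable,
  which is differentiable almost everywhere. A rational slope \<open>c\<close> and a scale
  \<open>1/(m+1)\<close> stand in for the derivative: the good set becomes a countable union of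
  closed sets, which gives the Borel measurability required for slicing.\<close>

lemma lipschitz_ae_directional:
  fixes f :: "'a::euclidean_space \<Rightarrow> real"
  assumes lip: "L-lipschitz_on UNIV f" and "0 < \<eta>"
  shows "negligible (- (\<Union>c\<in>\<rat>. \<Union>m. {x. \<forall>h. \<bar>h\<bar> < inverse (Suc m) \<longrightarrow>
            \<bar>f (x + h *\<^sub>R v) - f x - h * c\<bar> \<le> \<eta> * \<bar>h\<bar>}))" (is "negligible ?N")
proof (rule negligible_if_negligible_on_lines[of _ v])
  have cont: "continuous_on UNIV f" using lip by (rule lipschitz_on_continuous_on)
  have "closed {x. \<forall>h. \<bar>h\<bar> < inverse (Suc m) \<longrightarrow> \<bar>f (x + h *\<^sub>R v) - f x - h * c\<bar> \<le> \<eta> * \<bar>h\<bar>}" for m c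
    by (intro closed_Collect_all closed_Collect_imp open_Collect_const closed_Collect_le
        continuous_intros continuous_on_compose2[OF cont]) auto
  then show "?N \<in> sets borel"
    by (intro borel_comp sets.countable_UN' sets.countable_UN borel_closed image_subsetI) (auto simp: countable_rat)
  fix x
  define \<phi> where "\<phi> = (\<lambda>t. f (x + t *\<^sub>R v))"
  have "(L * norm v)-lipschitz_on UNIV \<phi>"
  proof (rule lipschitz_onI)
    fix s t :: real
    show "dist (\<phi> s) (\<phi> t) \<le> L * norm v * dist s t"
      using lipschitz_onD[OF lip, of "x + s *\<^sub>R v" "x + t *\<^sub>R v"]
      by (simp add: \<phi>_def dist_norm mult_ac flip: scaleR_diff_left)
  qed (use lipschitz_on_nonneg[OF lip] in auto)
  then have "negligible {t. \<not> (\<exists>l. ((\<lambda>h. (\<phi> (t + h) - \<phi> t) / h) \<longlongrightarrow> l) (at 0))}"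
    by (rule lipschitz_real_ae_differentiable)
  moreover have "{t. x + t *\<^sub>R v \<in> ?N} \<subseteq> {t. \<not> (\<exists>l. ((\<lambda>h. (\<phi> (t + h) - \<phi> t) / h) \<longlongrightarrow> l) (at 0))}"
  proof (intro subsetI CollectI notI)
    fix t assume t: "t \<in> {t. x + t *\<^sub>R v \<in> ?N}" and "\<exists>l. ((\<lambda>h. (\<phi> (t + h) - \<phi> t) / h) \<longlongrightarrow> l) (at 0)"
    then obtain l where l: "((\<lambda>h. (\<phi> (t + h) - \<phi> t) / h) \<longlongrightarrow> l) (at 0)" by blast
    \<comment> \<open>Half of the tolerance pays for rounding the derivative to a rational, half for
      the convergence of the quotients.\<close>
    obtain c where c: "c \<in> \<rat>" "l - \<eta>/2 < c" "c < l" using Rats_dense_in_real[of "l - \<eta>/2" l] \<open>0 < \<eta>\<close> by auto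
    have "\<forall>\<^sub>F h in at 0. dist ((\<phi> (t + h) - \<phi> t) / h) l < \<eta>/2"
      using tendstoD[OF l, of "\<eta>/2"] \<open>0 < \<eta>\<close> by simp
    then obtain d where d: "d > 0" "\<And>h. h \<noteq> 0 \<Longrightarrow> \<bar>h\<bar> < d \<Longrightarrow> \<bar>(\<phi> (t + h) - \<phi> t) / h - l\<bar> < \<eta>/2"
      unfolding eventually_at by (auto simp: dist_real_def)
    obtain m where m: "inverse (Suc m) < d" using reals_Archimedean[OF d(1)] by auto
    have "\<bar>\<phi> (t + h) - \<phi> t - h * c\<bar> \<le> \<eta> * \<bar>h\<bar>" if h: "\<bar>h\<bar> < inverse (Suc m)" for h
    proof (cases "h = 0")
      case False
      have "\<bar>(\<phi> (t + h) - \<phi> t) / h - c\<bar> \<le> \<eta>"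
        using d(2)[OF False] h m c by linarith
      then have "\<bar>(\<phi> (t + h) - \<phi> t) / h - c\<bar> * \<bar>h\<bar> \<le> \<eta> * \<bar>h\<bar>" by (rule mult_right_mono) simp
      moreover have "\<phi> (t + h) - \<phi> t - h * c = ((\<phi> (t + h) - \<phi> t) / h - c) * h"
        using False by (simp add: field_simps)
      ultimately show ?thesis by (simp add: abs_mult)
    qed simp
    then have "\<forall>h. \<bar>h\<bar> < inverse (Suc m) \<longrightarrow> \<bar>f ((x + t *\<^sub>R v) + h *\<^sub>R v) - f (x + t *\<^sub>R v) - h * c\<bar> \<le> \<eta> * \<bar>h\<bar>"
      by (simp add: \<phi>_def algebra_simps)
    then show False using t c(1) by blast
  qed
  ultimately show "negligible {t. x + t *\<^sub>R v \<in> ?N}" by (rule negligible_subset)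
qed

text \<open>The exceptional points form a porous set: each has arbitrarily small balls from which a
  fixed proportion, free of \<open>K\<close>, can be removed.\<close>

lemma negligible_far_from_closed:
  fixes K :: "'a::euclidean_space set"
  assumes "closed K" "0 < \<eta>" "\<eta> \<le> 1"
  shows "negligible {x\<in>K. \<forall>m::nat. \<exists>y. norm (y - x) < inverse (Suc m) \<and> \<eta> * norm (y - x) < infdist y K}"
    (is "negligible ?S")
proof -
  \<comment> \<open>The proportion of a ball of radius \<open>2 * r\<close> that is left after
    removing a ball of radius \<open>\<eta> * r\<close>.\<close>
  define \<kappa> where "\<kappa> = 1 - (\<eta>/2) ^ DIM('a)"
  have \<kappa>: "0 \<le> \<kappa>" "\<kappa> < 1" using assms by (auto simp: \<kappa>_def power_le_one)
  have S_borel: "?S \<in> sets borel"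
  proof -
    have op: "open (\<Union>y. {x. norm (y - x) < inverse (Suc m) \<and> \<eta> * norm (y - x) < infdist y K})" for m
      by (intro open_UN ballI open_Collect_conj open_Collect_less continuous_intros)
    have eq: "?S = K \<inter> (\<Inter>m. \<Union>y. {x. norm (y - x) < inverse (Suc m) \<and> \<eta> * norm (y - x) < infdist y K})"
      by auto
    show ?thesis unfolding eq
      by (intro sets.Int borel_closed[OF \<open>closed K\<close>] sets.countable_INT'' borel_open[OF op]) simp_all
  qed
  have "negligible (?S \<inter> cball 0 (real n))" for n
  proof -
    let ?A = "?S \<inter> cball 0 (real n)"
    have A: "?A \<in> lmeasurable"
      by (rule bounded_set_imp_lmeasurable) (use S_borel in \<open>auto intro!: bounded_Int\<close>)
    have "measure lebesgue ?A \<le> \<kappa> * measure lebesgue ?A"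
    proof (rule field_le_epsilon)
      fix e :: real assume "0 < e"
      obtain U where U: "open U" "?A \<subseteq> U" "U \<in> lmeasurable" "measure lebesgue U < measure lebesgue ?A + e"
        using lmeasurable_outer_open_measure [OF A \<open>0 < e\<close>] by blast
      define I where "I = {(x,y). x \<in> ?A \<and> x \<noteq> y \<and> cball x (2 * norm (y - x)) \<subseteq> U \<and> \<eta> * norm (y - x) < infdist y K}"
      define r where "r = (\<lambda>(x::'a, y). 2 * norm (y - x))"
      \<comment> \<open>The radius \<open>2 * norm (y - x)\<close> lets the ball around
        \<open>x\<close> contain the whole hole around \<open>y\<close>, because
        \<open>\<eta> \<le> 1\<close>. For indices in \<open>I\<close> the hole misses
        \<open>K\<close>, so \<open>V\<close> keeps all points of \<open>?A\<close> in the
        ball.\<close>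
      define V where "V = (\<lambda>(x::'a, y). cball x (2 * norm (y - x)) - ball y (\<eta> * norm (y - x)))"
      have fine: "\<exists>i\<in>I. x \<in> cball (fst i) (r i) \<and> r i < d" if x: "x \<in> ?A" and "0 < d" for x d
      proof -
        obtain k where k: "k > 0" "ball x k \<subseteq> U" using U x by (meson openE subsetD)
        have "0 < min d k / 2" using k \<open>0 < d\<close> by simp
        then obtain m where m: "inverse (Suc m) < min d k / 2" using reals_Archimedean by blast
        obtain y where y: "norm (y - x) < inverse (Suc m)" "\<eta> * norm (y - x) < infdist y K" using x by blast
        have "x \<noteq> y" using y x by auto
        moreover have "cball x (2 * norm (y - x)) \<subseteq> ball x k" using y m by (auto simp: cball_subset_ball_iff)
        ultimately have "(x,y) \<in> I" using y k x by (auto simp: I_def)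
        then show ?thesis using y m by (intro bexI[of _ "(x,y)"]) (auto simp: r_def)
      qed
      have pos: "0 < r i" if "i \<in> I" for i using that by (auto simp: I_def r_def)
      have sub: "cball (fst i) (r i) \<subseteq> U" if "i \<in> I" for i using that by (auto simp: I_def r_def)
      have Vm: "V i \<in> lmeasurable" if "i \<in> I" for i
        by (cases i) (auto simp: V_def intro!: fmeasurable.Diff)
      have Vle: "measure lebesgue (V i) \<le> \<kappa> * measure lebesgue (cball (fst i) (r i))" if "i \<in> I" for i
      proof -
        obtain x y where i: "i = (x,y)" by (cases i)
        let ?d = "norm (y - x)"
        have "\<eta> * ?d \<le> ?d" using assms by (simp add: mult_left_le_one_le)
        then have "ball y (\<eta> * ?d) \<subseteq> cball x (2 * ?d)"
          by (auto simp: ball_subset_cball_iff dist_norm)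
        then have "measure lebesgue (V i) = measure lebesgue (cball x (2 * ?d)) - measure lebesgue (ball y (\<eta> * ?d))"
          by (simp add: V_def i measurable_measure_Diff)
        also have "\<dots> = \<kappa> * measure lebesgue (cball x (2 * ?d))"
        proof -
          have "(\<eta>/2) ^ DIM('a) * (2 * ?d) ^ DIM('a) = (\<eta> * ?d) ^ DIM('a)"
            by (subst power_mult_distrib[symmetric]) simp
          moreover have "u * s - u * (a * s) = (1 - a) * (u * s)" for u a s :: real
            by (simp add: algebra_simps)
          ultimately show ?thesis
            using \<open>0 < \<eta>\<close> unfolding \<kappa>_def by (simp add: content_ball content_cball) metis
        qed
        finally show ?thesis by (simp add: i r_def)
      qed
      obtain D where D: "D \<subseteq> I" "negligible (?A - (\<Union>i\<in>D. cball (fst i) (r i)))"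
        "(\<Union>i\<in>D. V i) \<in> lmeasurable" "measure lebesgue (\<Union>i\<in>D. V i) \<le> \<kappa> * measure lebesgue U"
        by (rule Vitali_measure_bound [OF pos fine U(3) sub Vm Vle \<kappa>(1)])
      let ?N = "?A - (\<Union>i\<in>D. cball (fst i) (r i))"
      have "z \<in> V i" if z: "z \<in> ?A" "i \<in> D" "z \<in> cball (fst i) (r i)" for z i
      proof -
        obtain x y where i: "i = (x,y)" by (cases i)
        have "\<eta> * norm (y - x) < infdist y K" using z D(1) by (auto simp: I_def i)
        also have "\<dots> \<le> dist y z" using z by (intro infdist_le) auto
        finally show ?thesis using z by (auto simp: V_def i r_def)
      qed
      then have "?A \<subseteq> (\<Union>i\<in>D. V i) \<union> ?N" by blast
      then have "measure lebesgue ?A \<le> measure lebesgue ((\<Union>i\<in>D. V i) \<union> ?N)"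
        using A D(3) D(2) by (intro measure_mono_fmeasurable fmeasurable.Un) (auto simp: negligible_imp_measurable fmeasurableD)
      also have "\<dots> \<le> measure lebesgue (\<Union>i\<in>D. V i) + measure lebesgue ?N"
        using D(2,3) by (intro measure_Un_le) (auto simp: negligible_imp_measurable fmeasurableD)
      also have "\<dots> \<le> \<kappa> * measure lebesgue U" using D(2,4) by (simp add: negligible_imp_measure0)
      also have "\<dots> \<le> \<kappa> * (measure lebesgue ?A + e)" using U \<kappa> by (intro mult_left_mono) auto
      also have "\<dots> \<le> \<kappa> * measure lebesgue ?A + e"
        using \<kappa> \<open>0 < e\<close> by (simp add: algebra_simps mult_left_le_one_le)
      finally show "measure lebesgue ?A \<le> \<kappa> * measure lebesgue ?A + e" .
    qed
    then have "measure lebesgue ?A \<le> 0"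
      using \<kappa> measure_nonneg[of lebesgue ?A] by (auto simp: mult_le_cancel_right1)
    then show ?thesis using A by (simp add: negligible_iff_measure measure_le_0_iff)
  qed
  then show ?thesis by (rule negligible_Int_cball)
qed

text \<open>A substitute for Rademacher's theorem, at a fixed accuracy \<open>\<eta>\<close>. The coefficient vector \<open>c\<close>
  is constant on each set \<open>K c m\<close>; walking from \<open>x\<close> to \<open>y\<close> parallel to the axes, every corner
  of the path has a point of \<open>K c m\<close> nearby. Keeping \<open>c\<close> in a countable set makes the sets of good
  points Borel.\<close>

lemma lipschitz_ae_approx_linear:
  fixes f :: "'a::euclidean_space \<Rightarrow> real"
  assumes lip: "L-lipschitz_on UNIV f" and "0 < \<eta>"
  obtains C :: "'a set" where "countable C"
    "negligible {x. \<not> (\<exists>c\<in>C. \<exists>m. \<forall>y. norm (y - x) < inverse (real (Suc m)) \<longrightarrow> \<bar>f y - f x - c \<bullet> (y - x)\<bar> \<le> \<eta> * norm (y - x))}"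
proof -
  define n where "n = real DIM('a)"
  have n: "1 \<le> n" using DIM_positive[where 'a='a] by (simp add: n_def)
  have L: "0 \<le> L" using lip by (rule lipschitz_on_nonneg)
  have f: "\<bar>f x - f y\<bar> \<le> L * norm (x - y)" for x y
    using lipschitz_onD[OF lip, of x y] by (simp add: dist_norm)
  \<comment> \<open>One coordinate step costs at most \<open>\<theta> * d\<close> for the slope
    along the axis and \<open>2 * L * (\<theta> * (n * d))\<close> for moving both ends of the step
    between the path and a point of \<open>K c m\<close>. Over \<open>n\<close> steps this is at
    most \<open>\<eta> * d\<close>. The cap 1 is the range of the parameter in
    \<open>negligible_far_from_closed\<close>.\<close>
  define \<theta> where "\<theta> = min 1 (\<eta> / (n * (1 + 2 * L * n)))"
  have pos: "0 < n * (1 + 2 * L * n)" using n L by (simp add: add_pos_nonneg)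
  then have \<theta>: "0 < \<theta>" "\<theta> \<le> 1" using \<open>0 < \<eta>\<close> by (auto simp: \<theta>_def)
  have "\<theta> * (n * (1 + 2 * L * n)) \<le> \<eta> / (n * (1 + 2 * L * n)) * (n * (1 + 2 * L * n))"
    using pos by (intro mult_right_mono) (auto simp: \<theta>_def)
  also have "\<dots> = \<eta>" using pos by (intro nonzero_eq_divide_eq[THEN iffD1] less_imp_neq[symmetric]) auto
  finally have \<theta>': "n * (\<theta> * (1 + 2 * L * n)) \<le> \<eta>" using pos by (simp add: mult.left_commute[of n] less_imp_neq[symmetric])
  define C where "C = (\<lambda>g. \<Sum>b\<in>Basis. g b *\<^sub>R b) ` (Basis \<rightarrow>\<^sub>E \<rat> :: ('a \<Rightarrow> real) set)"
  have "countable C" unfolding C_def by (intro countable_image countable_PiE) (auto simp: countable_rat)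
  define K where "K = (\<lambda>c m. {x. \<forall>b\<in>Basis. \<forall>h. \<bar>h\<bar> < inverse (real (Suc m)) \<longrightarrow>
            \<bar>f (x + h *\<^sub>R b) - f x - h * (c \<bullet> b)\<bar> \<le> \<theta> * \<bar>h\<bar>})"
  have cont: "continuous_on UNIV f" using lip by (rule lipschitz_on_continuous_on)
  have K_closed: "closed (K c m)" for c m
    unfolding K_def Ball_def
    by (intro closed_Collect_all closed_Collect_imp open_Collect_const closed_Collect_le
        continuous_intros continuous_on_compose2[OF cont]) auto
  define N1 where "N1 = (\<Union>b\<in>Basis. - (\<Union>c\<in>\<rat>. \<Union>m. {x. \<forall>h. \<bar>h\<bar> < inverse (real (Suc m)) \<longrightarrow>
            \<bar>f (x + h *\<^sub>R b) - f x - h * c\<bar> \<le> \<theta> * \<bar>h\<bar>}))"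
  define N2 where "N2 = (\<Union>c\<in>C. \<Union>m. {x\<in>K c m. \<forall>k::nat. \<exists>y. norm (y - x) < inverse (Suc k) \<and> \<theta> * norm (y - x) < infdist y (K c m)})"
  have "negligible N1" unfolding N1_def
    by (intro negligible_Union) (use lipschitz_ae_directional[OF lip \<theta>(1)] in \<open>auto simp del: Compl_UN\<close>)
  have "negligible N2" unfolding N2_def
  proof (rule negligible_countable_Union, goal_cases)
    case (2 S)
    then show ?case using negligible_far_from_closed[OF K_closed \<theta>(1,2)]
      by (auto intro!: negligible_Union_nat)
  qed (use \<open>countable C\<close> in auto)
  have "\<exists>c\<in>C. \<exists>m. \<forall>y. norm (y - x) < inverse (real (Suc m)) \<longrightarrow> \<bar>f y - f x - c \<bullet> (y - x)\<bar> \<le> \<eta> * norm (y - x)"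
    if x: "x \<notin> N1" "x \<notin> N2" for x
  proof -
    have "\<forall>b\<in>Basis. \<exists>c m. c \<in> \<rat> \<and> (\<forall>h. \<bar>h\<bar> < inverse (real (Suc m)) \<longrightarrow>
            \<bar>f (x + h *\<^sub>R b) - f x - h * c\<bar> \<le> \<theta> * \<bar>h\<bar>)"
      using x(1) unfolding N1_def by blast
    then obtain cf mf where cf: "\<And>b. b \<in> Basis \<Longrightarrow> cf b \<in> \<rat>"
      and mf: "\<And>b h. b \<in> Basis \<Longrightarrow> \<bar>h\<bar> < inverse (real (Suc (mf b))) \<Longrightarrow> \<bar>f (x + h *\<^sub>R b) - f x - h * cf b\<bar> \<le> \<theta> * \<bar>h\<bar>"
      by metis
    define c where "c = (\<Sum>b\<in>Basis. cf b *\<^sub>R b)"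
    have cC: "c \<in> C" unfolding C_def c_def
      by (rule image_eqI[of _ _ "restrict cf Basis"]) (use cf in auto)
    have cb: "c \<bullet> b = cf b" if "b \<in> Basis" for b
      using that by (simp add: c_def)
    define m where "m = Max (mf ` Basis)"
    have mm: "inverse (real (Suc m)) \<le> inverse (real (Suc (mf b)))" if "b \<in> Basis" for b
      using that by (simp add: m_def)
    have xK: "x \<in> K c m"
      unfolding K_def
    proof (intro CollectI ballI allI impI)
      fix b :: 'a and h :: real assume b: "b \<in> Basis" "\<bar>h\<bar> < inverse (real (Suc m))"
      show "\<bar>f (x + h *\<^sub>R b) - f x - h * (c \<bullet> b)\<bar> \<le> \<theta> * \<bar>h\<bar>"
        unfolding cb[OF b(1)] by (rule mf[OF b(1) order_less_le_trans[OF b(2) mm[OF b(1)]]])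
    qed
    have "\<not> (\<forall>k::nat. \<exists>y. norm (y - x) < inverse (Suc k) \<and> \<theta> * norm (y - x) < infdist y (K c m))"
    proof
      assume "\<forall>k::nat. \<exists>y. norm (y - x) < inverse (Suc k) \<and> \<theta> * norm (y - x) < infdist y (K c m)"
      then have "x \<in> N2" using cC xK unfolding N2_def by blast
      then show False using x(2) by blast
    qed
    then obtain k where k: "\<And>y. norm (y - x) < inverse (real (Suc k)) \<Longrightarrow> infdist y (K c m) \<le> \<theta> * norm (y - x)"
      by (meson not_less)
    \<comment> \<open>A corner of the path may be as far as \<open>n * norm (y - x)\<close> from
      \<open>x\<close>. Dividing by \<open>n\<close> keeps the corners within the scale of
      \<open>k\<close>, where \<open>K c m\<close> is close, and the steps within the scale of
      \<open>m\<close>.\<close>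
    have "0 < inverse (real (Suc (max m k))) / n" using n by simp
    then obtain j where j: "inverse (real (Suc j)) < inverse (real (Suc (max m k))) / n"
      using reals_Archimedean by blast
    have "\<bar>f y - f x - c \<bullet> (y - x)\<bar> \<le> \<eta> * norm (y - x)" if y: "norm (y - x) < inverse (real (Suc j))" for y
    proof -
      define d where "d = norm (y - x)"
      have "n * d < inverse (real (Suc (max m k)))" 
      proof -
        have "d < inverse (real (Suc (max m k))) / n" using y j by (simp only: d_def)
        then show ?thesis using n by (simp only: pos_less_divide_eq mult.commute)
      qed
      moreover have "inverse (real (Suc (max m k))) \<le> inverse (real (Suc k))" "inverse (real (Suc (max m k))) \<le> inverse (real (Suc m))"
        by (auto simp: field_simps)
      moreover have "d \<le> n * d" using n by (simp add: d_def mult_le_cancel_right1)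
      ultimately have small: "n * d < inverse (real (Suc k))" "d < inverse (real (Suc m))" by linarith+
      define P where "P = (\<lambda>B. x + (\<Sum>b\<in>B. ((y - x) \<bullet> b) *\<^sub>R b))"
      have t: "\<bar>(y - x) \<bullet> b\<bar> \<le> d" if "b \<in> Basis" for b using Basis_le_norm[OF that] by (simp add: d_def)
      have Pd: "norm (P B - x) \<le> n * d" if "B \<subseteq> Basis" for B
      proof -
        have "norm (P B - x) \<le> (\<Sum>b\<in>B. norm (((y - x) \<bullet> b) *\<^sub>R b))" unfolding P_def add_diff_cancel_left' by (rule norm_sum)
        also have "\<dots> \<le> (\<Sum>b\<in>B. d)" using that t by (intro sum_mono) (auto simp: subset_iff)
        also have "\<dots> \<le> n * d" using that by (simp add: n_def d_def card_mono mult_right_mono)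
        finally show ?thesis .
      qed
      have "\<bar>f (P B) - f x - (\<Sum>b\<in>B. ((y - x) \<bullet> b) * (c \<bullet> b))\<bar> \<le> real (card B) * (\<theta> * (1 + 2 * L * n) * d)"
        if "finite B" "B \<subseteq> Basis" for B
        using that
      proof (induction B rule: finite_induct)
        case (insert b B)
        let ?t = "(y - x) \<bullet> b"
        have b: "b \<in> Basis" "B \<subseteq> Basis" using insert.prems by auto
        have "infdist (P B) (K c m) \<le> \<theta> * norm (P B - x)"
          using Pd[OF b(2)] small by (intro k) linarith
        \<comment> \<open>The slope estimate holds at points of \<open>K c m\<close>, so the step
          along \<open>b\<close> is taken from the nearest such point \<open>z\<close>; the
          Lipschitz bound, used at both ends of the step, transfers it to the corner.\<close>
        moreover obtain z where z: "z \<in> K c m" "infdist (P B) (K c m) = dist (P B) z"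
          using infdist_attains_inf[OF K_closed] xK by blast
        ultimately have "norm (P B - z) \<le> \<theta> * (n * d)"
          using Pd[OF b(2)] \<theta>(1) by (smt (verit) dist_norm mult_left_mono)
        then have zL: "L * norm (P B - z) \<le> L * (\<theta> * (n * d))" using L by (rule mult_left_mono)
        have 1: "\<bar>f (z + ?t *\<^sub>R b) - f z - ?t * (c \<bullet> b)\<bar> \<le> \<theta> * \<bar>?t\<bar>"
          using z(1) b t[OF b(1)] small unfolding K_def by auto
        have 2: "\<theta> * \<bar>?t\<bar> \<le> \<theta> * d" using t[OF b(1)] \<theta> by (intro mult_left_mono) auto
        have 3: "\<bar>f (P B) - f z\<bar> \<le> L * norm (P B - z)" by (rule f)
        have 4: "\<bar>f (P B + ?t *\<^sub>R b) - f (z + ?t *\<^sub>R b)\<bar> \<le> L * norm (P B - z)"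
          using f[of "P B + ?t *\<^sub>R b" "z + ?t *\<^sub>R b"] by simp
        have P: "P (insert b B) = P B + ?t *\<^sub>R b" using insert.hyps by (simp add: P_def)
        have S: "(\<Sum>b\<in>insert b B. ((y - x) \<bullet> b) * (c \<bullet> b)) = ?t * (c \<bullet> b) + (\<Sum>b\<in>B. ((y - x) \<bullet> b) * (c \<bullet> b))"
          using insert.hyps by simp
        have R: "real (card (insert b B)) * (\<theta> * (1 + 2 * L * n) * d)
            = real (card B) * (\<theta> * (1 + 2 * L * n) * d) + \<theta> * d + 2 * (L * (\<theta> * (n * d)))"
          using insert.hyps by (simp add: algebra_simps)
        show ?case unfolding P S R using insert.IH[OF b(2)] 1 2 3 4 zL by linarith
      qed (simp add: P_def)
      from this[of Basis] have "\<bar>f (P Basis) - f x - (\<Sum>b\<in>Basis. ((y - x) \<bullet> b) * (c \<bullet> b))\<bar> \<le> (n * (\<theta> * (1 + 2 * L * n))) * d"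
        by (simp add: n_def mult_ac)
      also have "\<dots> \<le> \<eta> * d" using \<theta>' by (rule mult_right_mono) (simp add: d_def)
      finally have "\<bar>f (P Basis) - f x - (\<Sum>b\<in>Basis. ((y - x) \<bullet> b) * (c \<bullet> b))\<bar> \<le> \<eta> * d" .
      moreover have "P Basis = y"
        unfolding P_def euclidean_representation by simp
      moreover have "(\<Sum>b\<in>Basis. ((y - x) \<bullet> b) * (c \<bullet> b)) = c \<bullet> (y - x)"
        unfolding euclidean_inner[of c "y - x"] by (intro sum.cong refl mult.commute)
      ultimately show ?thesis by (simp only: d_def)
    qed
    then show ?thesis using cC by blast
  qed
  then have "{x. \<not> (\<exists>c\<in>C. \<exists>m. \<forall>y. norm (y - x) < inverse (real (Suc m)) \<longrightarrow> \<bar>f y - f x - c \<bullet> (y - x)\<bar> \<le> \<eta> * norm (y - x))}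
    \<subseteq> N1 \<union> N2" by blast
  then show ?thesis
    using that[OF \<open>countable C\<close>] negligible_subset[OF negligible_Un[OF \<open>negligible N1\<close> \<open>negligible N2\<close>]] by blast
qed

section \<open>Mollification\<close>

text \<open>Squaring the positive part removes its corner. This C1 function is the common building
  block of the mollifying kernel and of the cutoffs between shells.\<close>

lemma has_real_derivative_max0_power2:
  "((\<lambda>t::real. (max 0 t)\<^sup>2) has_real_derivative 2 * max 0 t) (at t)"
proof -
  consider "t < 0" | "t = 0" | "0 < t" by linarith
  then show ?thesis
  proof cases
    case 1
    have "((\<lambda>t::real. 0) has_real_derivative 2 * max 0 t) (at t)" using 1 by simp
    then show ?thesis
      by (rule has_field_derivative_transform_within_open[of _ _ _ "{..<0}"]) (use 1 in auto)
  next
    case 2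
    have "((\<lambda>h::real. \<bar>h\<bar>) \<longlongrightarrow> 0) (at 0)" by (rule tendsto_eq_intros | simp)+
    moreover have "\<forall>\<^sub>F h in at (0::real). norm (((max 0 (0 + h))\<^sup>2 - (max 0 0)\<^sup>2) / h) \<le> \<bar>h\<bar>"
      by (auto simp: eventually_at power2_eq_square max_def abs_mult intro!: exI[of _ 1])
    ultimately have "((\<lambda>h. ((max 0 (0 + h))\<^sup>2 - (max 0 0)\<^sup>2) / h) \<longlongrightarrow> (0::real)) (at 0)"
      by (rule Lim_null_comparison[rotated])
    then show ?thesis by (simp add: 2 DERIV_def)
  next
    case 3
    have "((\<lambda>t::real. t\<^sup>2) has_real_derivative 2 * max 0 t) (at t)"
      using 3 by (auto intro!: derivative_eq_intros)
    then show ?thesis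
      by (rule has_field_derivative_transform_within_open[of _ _ _ "{0<..}"]) (use 3 in auto)
  qed
qed

text \<open>One continuous derivative is all that is asked of the kernel, so it is a truncated
  polynomial in \<open>z \<bullet> z\<close> with explicit bounds. It is not normalised;
  \<open>mollify\<close> divides by its integral.\<close>

definition bump :: "real \<Rightarrow> 'a::euclidean_space \<Rightarrow> real" where
  "bump \<delta> z = (max 0 (1 - (z \<bullet> z) / \<delta>\<^sup>2))\<^sup>2"

definition bump_deriv :: "real \<Rightarrow> 'a::euclidean_space \<Rightarrow> 'a \<Rightarrow>\<^sub>L real" where
  "bump_deriv \<delta> z = (- (4 / \<delta>\<^sup>2) * max 0 (1 - (z \<bullet> z) / \<delta>\<^sup>2)) *\<^sub>R blinfun_inner_right z"

lemma bump_has_derivative: "(bump \<delta> has_derivative blinfun_apply (bump_deriv \<delta> z)) (at z)"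
proof -
  let ?u = "\<lambda>z::'a. 1 - (z \<bullet> z) / \<delta>\<^sup>2"
  have "(?u has_derivative (\<lambda>h. - (2 * (z \<bullet> h)) / \<delta>\<^sup>2)) (at z)"
    unfolding divide_inverse by (auto intro!: derivative_eq_intros simp: inner_commute)
  from has_derivative_compose[OF this has_real_derivative_max0_power2[unfolded has_field_derivative_def]]
  show ?thesis
    unfolding bump_def[abs_def] bump_deriv_def
    by (rule has_derivative_eq_rhs) (auto simp: fun_eq_iff blinfun.scaleR_left blinfun.minus_left mult_ac)
qed

lemma continuous_on_bump [continuous_intros]:
  "continuous_on S f \<Longrightarrow> continuous_on S (\<lambda>x. bump \<delta> (f x))"
  \<comment> \<open>For \<open>\<delta> = 0\<close> the quotient is 0 by convention, so the kernel
    is constant and still continuous.\<close>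
  unfolding bump_def by (cases "\<delta> = 0") (auto intro!: continuous_intros)

lemma continuous_on_bump_deriv [continuous_intros]:
  "continuous_on S f \<Longrightarrow> continuous_on S (\<lambda>x. bump_deriv \<delta> (f x))"
  unfolding bump_deriv_def by (cases "\<delta> = 0") (auto intro!: continuous_intros bounded_linear.continuous_on[OF bounded_linear_blinfun_inner_right])

lemma bump_nonneg [simp]: "0 \<le> bump \<delta> z"
  by (simp add: bump_def)

lemma bump_minus [simp]: "bump \<delta> (- z) = bump \<delta> z"
  by (simp add: bump_def)

lemma bump_eq_0: "0 < \<delta> \<Longrightarrow> \<delta> \<le> norm z \<Longrightarrow> bump \<delta> z = 0"
  using power_mono[of \<delta> "norm z" 2] by (auto simp: bump_def power2_norm_eq_inner max_def field_simps)

text \<open>The gradient is \<open>- (4 / \<delta>\<^sup>2)\<close> times the positive part times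
  \<open>z\<close>. The positive part is at most 1 and vanishes when \<open>norm z\<close> exceeds
  \<open>\<delta>\<close>, which leaves \<open>4 / \<delta>\<close>.\<close>

lemma bump_lipschitz:
  fixes x y :: "'a::euclidean_space"
  assumes "0 < \<delta>"
  shows "\<bar>bump \<delta> x - bump \<delta> y\<bar> \<le> 4 / \<delta> * norm (x - y)"
proof -
  have "onorm (blinfun_apply (bump_deriv \<delta> z)) \<le> 4 / \<delta>" for z :: 'a
  proof (rule onorm_le)
    fix h :: 'a
    have "norm z * max 0 (1 - (z \<bullet> z) / \<delta>\<^sup>2) \<le> \<delta>"
    proof (cases "norm z \<le> \<delta>")
      case True
      then have "norm z * max 0 (1 - (z \<bullet> z) / \<delta>\<^sup>2) \<le> \<delta> * 1" using \<open>0 < \<delta>\<close> by (intro mult_mono) auto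
      then show ?thesis by simp
    next
      case False
      then have "\<delta>\<^sup>2 \<le> (norm z)\<^sup>2" using \<open>0 < \<delta>\<close> by (intro power_mono) auto
      then have "max 0 (1 - (z \<bullet> z) / \<delta>\<^sup>2) = 0"
        using \<open>0 < \<delta>\<close> by (simp add: power2_norm_eq_inner max_def field_simps)
      then show ?thesis using \<open>0 < \<delta>\<close> by simp
    qed
    then have z: "(4 / \<delta>\<^sup>2) * (norm z * max 0 (1 - (z \<bullet> z) / \<delta>\<^sup>2)) \<le> (4 / \<delta>\<^sup>2) * \<delta>"
      by (intro mult_left_mono) auto
    have "norm (bump_deriv \<delta> z h) = (4 / \<delta>\<^sup>2) * max 0 (1 - (z \<bullet> z) / \<delta>\<^sup>2) * \<bar>z \<bullet> h\<bar>"
      by (simp add: bump_deriv_def blinfun.scaleR_left blinfun.minus_left abs_mult)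
    also have "\<dots> \<le> (4 / \<delta>\<^sup>2) * max 0 (1 - (z \<bullet> z) / \<delta>\<^sup>2) * (norm z * norm h)"
      by (intro mult_left_mono Cauchy_Schwarz_ineq2) auto
    also have "\<dots> = ((4 / \<delta>\<^sup>2) * (norm z * max 0 (1 - (z \<bullet> z) / \<delta>\<^sup>2))) * norm h" by (simp only: mult_ac)
    also have "\<dots> \<le> ((4 / \<delta>\<^sup>2) * \<delta>) * norm h" using z by (rule mult_right_mono) simp
    also have "(4 / \<delta>\<^sup>2) * \<delta> = 4 / \<delta>" using \<open>0 < \<delta>\<close> by (simp add: power2_eq_square)
    finally show "norm (bump_deriv \<delta> z h) \<le> 4 / \<delta> * norm h" .
  qed
  then have "norm (bump \<delta> x - bump \<delta> y) \<le> 4 / \<delta> * norm (x - y)"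
    by (intro differentiable_bound[of UNIV "bump \<delta>" "\<lambda>z. blinfun_apply (bump_deriv \<delta> z)"])
       (auto intro: bump_has_derivative)
  then show ?thesis by simp
qed

lemma integrable_mult_bump:
  fixes F :: "'a::euclidean_space \<Rightarrow> real"
  assumes "continuous_on UNIV F" "0 < \<delta>"
  shows "integrable lborel (\<lambda>u. F u * bump \<delta> (x - u))"
proof -
  have "integrable lborel (\<lambda>u. indicator (cball x \<delta>) u *\<^sub>R (F u * bump \<delta> (x - u)))"
    by (intro borel_integrable_compact continuous_intros continuous_on_subset[OF assms(1)]) auto
  moreover have "indicator (cball x \<delta>) u *\<^sub>R (F u * bump \<delta> (x - u)) = F u * bump \<delta> (x - u)" for u
    using bump_eq_0[OF \<open>0 < \<delta>\<close>, of "x - u"] by (auto simp: indicator_def dist_norm)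
  ultimately show ?thesis by (simp only:)
qed

lemma integrable_bump:
  assumes "0 < \<delta>" shows "integrable lborel (bump \<delta> :: 'a::euclidean_space \<Rightarrow> real)"
  using integrable_mult_bump[of "\<lambda>_. 1" \<delta> "0::'a"] assms by simp

lemma lborel_integral_reflect:
  fixes F :: "'a::euclidean_space \<Rightarrow> real"
  assumes [measurable]: "F \<in> borel_measurable borel"
  shows "(\<integral>u. F u \<partial>lborel) = (\<integral>z. F (x - z) \<partial>lborel)"
proof -
  have "lborel = distr lborel borel (\<lambda>z. x - z)"
    using lborel_affine[of "-1" x] by (simp add: density_1)
  then have "(\<integral>u. F u \<partial>lborel) = (\<integral>u. F u \<partial>distr lborel borel (\<lambda>z. x - z))" by simp
  also have "\<dots> = (\<integral>z. F (x - z) \<partial>lborel)" by (rule integral_distr) auto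
  finally show ?thesis .
qed

text \<open>On the ball of radius \<open>\<delta>/2\<close> the kernel is at least
  \<open>(3/4)\<^sup>2\<close>, hence at least 1/2. The bound compares the mass of the kernel with
  the volume of its support, by a factor independent of \<open>\<delta>\<close>.\<close>

lemma integral_bump_lower:
  assumes "0 < \<delta>"
  shows "measure lborel (ball (0::'a::euclidean_space) \<delta>) / 2 ^ DIM('a) / 2 \<le> (\<integral>u. bump \<delta> (u::'a) \<partial>lborel)"
proof -
  have "measure lborel (ball (0::'a) \<delta>) / 2 ^ DIM('a) / 2 = (\<integral>u. indicator (ball (0::'a) (\<delta>/2)) u * (1/2) \<partial>lborel)"
    using assms by (simp add: content_ball power_divide)
  also have "\<dots> \<le> (\<integral>u. bump \<delta> (u::'a) \<partial>lborel)"
  proof (rule integral_mono)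
    fix u :: 'a
    have "1/2 \<le> bump \<delta> u" if "norm u < \<delta> / 2"
    proof -
      have "(norm u)\<^sup>2 \<le> (\<delta>/2)\<^sup>2" using that by (intro power_mono) auto
      then have "3/4 \<le> 1 - (u \<bullet> u) / \<delta>\<^sup>2"
        using assms by (simp add: power2_norm_eq_inner power_divide field_simps)
      then have "3/4 \<le> max 0 (1 - (u \<bullet> u) / \<delta>\<^sup>2)" by linarith
      then have "(3/4)\<^sup>2 \<le> bump \<delta> u" unfolding bump_def by (rule power_mono) simp
      then show ?thesis by (simp add: power2_eq_square)
    qed
    then show "indicator (ball 0 (\<delta>/2)) u * (1/2) \<le> bump \<delta> u" by (auto simp: indicator_def)
    show "integrable lborel (\<lambda>u. indicator (ball (0::'a) (\<delta>/2)) u * (1/2::real))"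
      by (intro integrable_mult_left integrable_real_indicator emeasure_bounded_finite) auto
  qed (use assms in \<open>auto intro!: integrable_bump\<close>)
  finally show ?thesis .
qed

lemma integral_bump_pos: "0 < \<delta> \<Longrightarrow> 0 < (\<integral>u. bump \<delta> (u::'a::euclidean_space) \<partial>lborel)"
  by (rule order_less_le_trans[OF _ integral_bump_lower]) simp_all

definition mollify :: "real \<Rightarrow> ('a::euclidean_space \<Rightarrow> real) \<Rightarrow> 'a \<Rightarrow> real" where
  "mollify \<delta> F x = (\<integral>u. F u * bump \<delta> (x - u) \<partial>lborel) / (\<integral>u. bump \<delta> (u::'a) \<partial>lborel)"

lemma integrable_shift_bump:
  fixes F :: "'a::euclidean_space \<Rightarrow> real"
  assumes "continuous_on UNIV F" "0 < \<delta>"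
  shows "integrable lborel (\<lambda>z. F (x - z) * bump \<delta> z)"
proof -
  have "continuous_on UNIV (\<lambda>z. F (x - z))"
    by (intro continuous_on_compose2[OF assms(1)] continuous_intros) auto
  from integrable_mult_bump[OF this assms(2), of 0] show ?thesis by simp
qed

lemma mollify_shift:
  fixes F :: "'a::euclidean_space \<Rightarrow> real"
  assumes F: "continuous_on UNIV F" and "0 < \<delta>"
  shows "mollify \<delta> F x = (\<integral>z. F (x - z) * bump \<delta> z \<partial>lborel) / (\<integral>u. bump \<delta> (u::'a) \<partial>lborel)"
proof -
  have "(\<lambda>u. F u * bump \<delta> (x - u)) \<in> borel_measurable borel"
    using integrable_mult_bump[OF F \<open>0 < \<delta>\<close>] by simp
  from lborel_integral_reflect[OF this, of x] show ?thesis by (simp add: mollify_def)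
qed

text \<open>A mollification averages translates of \<open>F\<close> over shifts shorter than
  \<open>\<delta>\<close>, so a bound on increments common to these shifts survives. With
  \<open>a = 0\<close> it preserves a Lipschitz bound; with \<open>b = 0\<close> it shows that
  increments of affine functions are reproduced exactly.\<close>

lemma mollify_diff_le:
  fixes F :: "'a::euclidean_space \<Rightarrow> real"
  assumes F: "continuous_on UNIV F" and "0 < \<delta>"
    and le: "\<And>z. norm z < \<delta> \<Longrightarrow> \<bar>F (x - z) - F (y - z) - a\<bar> \<le> b"
  shows "\<bar>mollify \<delta> F x - mollify \<delta> F y - a\<bar> \<le> b"
proof -
  let ?m = "\<integral>u. bump \<delta> (u::'a) \<partial>lborel"
  have m: "0 < ?m" by (rule integral_bump_pos) fact
  have i: "integrable lborel (\<lambda>z. F (w - z) * bump \<delta> z)" for w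
    using integrable_shift_bump[OF F \<open>0 < \<delta>\<close>] .
  have j: "integrable lborel (bump \<delta> :: 'a \<Rightarrow> real)" by (rule integrable_bump) fact
  have "(mollify \<delta> F x - mollify \<delta> F y - a) * ?m
      = (\<integral>z. F (x - z) * bump \<delta> z \<partial>lborel) - (\<integral>z. F (y - z) * bump \<delta> z \<partial>lborel) - (\<integral>z. a * bump \<delta> (z::'a) \<partial>lborel)"
    unfolding mollify_shift[OF F \<open>0 < \<delta>\<close>] using m by (simp add: field_simps)
  also have "\<dots> = (\<integral>z. (F (x - z) - F (y - z) - a) * bump \<delta> z \<partial>lborel)"
    using i j by (simp add: left_diff_distrib)
  also have "\<bar>\<dots>\<bar> \<le> (\<integral>z. b * bump \<delta> (z::'a) \<partial>lborel)"
  proof (rule integral_abs_bound[THEN order_trans], rule integral_mono)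
    show "integrable lborel (\<lambda>z. \<bar>(F (x - z) - F (y - z) - a) * bump \<delta> z\<bar>)"
      using i j by (intro integrable_abs) (simp add: left_diff_distrib)
    fix z
    show "\<bar>(F (x - z) - F (y - z) - a) * bump \<delta> z\<bar> \<le> b * bump \<delta> z"
    proof (cases "norm z < \<delta>")
      case True
      then show ?thesis using le by (auto simp: abs_mult intro!: mult_right_mono)
    qed (use bump_eq_0[OF \<open>0 < \<delta>\<close>, of z] in auto)
  qed (use j in auto)
  finally have "\<bar>mollify \<delta> F x - mollify \<delta> F y - a\<bar> * ?m \<le> b * ?m"
    using m by (simp add: abs_mult)
  then show ?thesis using m by simp
qed

lemma mollify_lipschitz:
  fixes f :: "'a::euclidean_space \<Rightarrow> real"
  assumes "L-lipschitz_on UNIV f" "0 < \<delta>"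
  shows "\<bar>mollify \<delta> f x - mollify \<delta> f y\<bar> \<le> L * norm (x - y)"
proof -
  have "\<bar>f (x - z) - f (y - z) - 0\<bar> \<le> L * norm (x - y)" for z
    using lipschitz_onD[OF assms(1), of "x - z" "y - z"] by (simp add: dist_norm)
  from mollify_diff_le[OF lipschitz_on_continuous_on[OF assms(1)] assms(2) this]
  show ?thesis by simp
qed

lemma mollify_close:
  fixes f :: "'a::euclidean_space \<Rightarrow> real"
  assumes lip: "L-lipschitz_on UNIV f" and "0 < \<delta>"
  shows "\<bar>mollify \<delta> f x - f x\<bar> \<le> L * \<delta>"
proof -
  let ?m = "\<integral>u. bump \<delta> (u::'a) \<partial>lborel"
  have m: "0 < ?m" by (rule integral_bump_pos) fact
  have i: "integrable lborel (\<lambda>z. f (x - z) * bump \<delta> z)"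
    using integrable_shift_bump[OF lipschitz_on_continuous_on[OF lip] \<open>0 < \<delta>\<close>] .
  have j: "integrable lborel (bump \<delta> :: 'a \<Rightarrow> real)" by (rule integrable_bump) fact
  have "(mollify \<delta> f x - f x) * ?m = (\<integral>z. (f (x - z) - f x) * bump \<delta> z \<partial>lborel)"
    unfolding mollify_shift[OF lipschitz_on_continuous_on[OF lip] \<open>0 < \<delta>\<close>]
    using m i j by (simp add: field_simps left_diff_distrib)
  also have "\<bar>\<dots>\<bar> \<le> (\<integral>z. (L * \<delta>) * bump \<delta> (z::'a) \<partial>lborel)"
  proof (rule integral_abs_bound[THEN order_trans], rule integral_mono)
    show "integrable lborel (\<lambda>z. \<bar>(f (x - z) - f x) * bump \<delta> z\<bar>)"
      using i j by (intro integrable_abs) (simp add: left_diff_distrib)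
    fix z :: 'a
    show "\<bar>(f (x - z) - f x) * bump \<delta> z\<bar> \<le> L * \<delta> * bump \<delta> z"
    proof (cases "norm z < \<delta>")
      case True
      have "\<bar>f (x - z) - f x\<bar> \<le> L * norm z"
        using lipschitz_onD[OF lip, of "x - z" x] by (simp add: dist_norm)
      also have "\<dots> \<le> L * \<delta>" using True lipschitz_on_nonneg[OF lip] by (intro mult_left_mono) auto
      finally show ?thesis by (auto simp: abs_mult intro!: mult_right_mono)
    qed (use bump_eq_0[OF \<open>0 < \<delta>\<close>, of z] in auto)
  qed (use j in auto)
  finally have "\<bar>mollify \<delta> f x - f x\<bar> * ?m \<le> (L * \<delta>) * ?m"
    using m by (simp add: abs_mult)
  then show ?thesis using m by simp
qed

text \<open>Differentiation falls on the kernel and not on \<open>f\<close>. The bounded support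
  turns the integral over the whole space into one over a box independent of \<open>x\<close>, where
  the Leibniz rule applies.\<close>

lemma mollify_C1:
  fixes f :: "'a::euclidean_space \<Rightarrow> real"
  assumes f: "continuous_on UNIV f" and supp: "\<And>x. T \<le> norm x \<Longrightarrow> f x = 0" and "0 < \<delta>"
  shows "C1_UNIV (mollify \<delta> f)"
proof -
  let ?m = "\<integral>u. bump \<delta> (u::'a) \<partial>lborel"
  obtain a b where ab: "cball (0::'a) T \<subseteq> cbox a b"
    using bounded_subset_cbox_symmetric[OF bounded_cball] by metis
  have eq: "(\<integral>u. f u * bump \<delta> (x - u) \<partial>lborel) = integral (cbox a b) (\<lambda>u. f u * bump \<delta> (x - u))" for x
  proof -
    have "(\<integral>u. f u * bump \<delta> (x - u) \<partial>lborel) = integral UNIV (\<lambda>u. f u * bump \<delta> (x - u))"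
      by (intro integral_lborel[symmetric] integrable_mult_bump f \<open>0 < \<delta>\<close>)
    also have "\<dots> = integral UNIV (\<lambda>u. if u \<in> cbox a b then f u * bump \<delta> (x - u) else 0)"
    proof (rule integral_cong)
      fix u :: 'a
      show "f u * bump \<delta> (x - u) = (if u \<in> cbox a b then f u * bump \<delta> (x - u) else 0)"
        using supp[of u] ab by (cases "norm u < T") (auto simp: subset_iff)
    qed
    finally show ?thesis by (simp add: integral_restrict_UNIV)
  qed
  let ?D = "\<lambda>x u. f u *\<^sub>R bump_deriv \<delta> (x - u)"
  have cD: "continuous_on (UNIV \<times> cbox a b) (\<lambda>(x, u). ?D x u)"
    unfolding split_beta by (intro continuous_intros continuous_on_compose2[OF f]) auto
  have D: "((\<lambda>x. integral (cbox a b) (\<lambda>u. f u * bump \<delta> (x - u))) has_derivative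
          blinfun_apply (integral (cbox a b) (?D x))) (at x)" for x
  proof (rule leibniz_rule[of UNIV])
    fix x u :: 'a
    have "((\<lambda>x. bump \<delta> (x - u)) has_derivative (\<lambda>h. bump_deriv \<delta> (x - u) h)) (at x)"
      by (rule has_derivative_compose[OF _ bump_has_derivative, of "\<lambda>x. x - u" "\<lambda>h. h" x UNIV, simplified])
         (auto intro!: derivative_eq_intros)
    then show "((\<lambda>x. f u * bump \<delta> (x - u)) has_derivative blinfun_apply (?D x u)) (at x)"
      by (rule has_derivative_mult_right[THEN has_derivative_eq_rhs]) (auto simp: blinfun.scaleR_left)
  next
    fix x :: 'a
    show "(\<lambda>u. f u * bump \<delta> (x - u)) integrable_on cbox a b"
      by (intro integrable_continuous continuous_intros continuous_on_subset[OF f]) auto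
  qed (use cD in auto)
  have "continuous_on UNIV (\<lambda>x. integral (cbox a b) (?D x))"
    using integral_continuous_on_param[of UNIV a b ?D] cD by simp
  moreover have "(mollify \<delta> f has_derivative blinfun_apply (inverse ?m *\<^sub>R integral (cbox a b) (?D x))) (at x)" for x
    unfolding mollify_def[abs_def] eq divide_inverse_commute
    by (rule has_derivative_mult_right[OF D, THEN has_derivative_eq_rhs]) (auto simp: blinfun.scaleR_left)
  ultimately show ?thesis
    unfolding C1_UNIV_def by (intro exI[of _ "\<lambda>x. inverse ?m *\<^sub>R integral (cbox a b) (?D x)"]) (auto intro!: continuous_intros)
qed

text \<open>The affine part contributes its exact increment. The remainder \<open>h\<close> is at
  most \<open>e\<close> on the supports of both kernels, whose union has at most twice the volume of
  a ball of radius \<open>\<delta>\<close>; the kernels differ by at most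
  \<open>4 / \<delta> * norm (y - x)\<close>, and such a ball has volume at most
  \<open>2 * 2 ^ DIM('a)\<close> times the mass of the kernel. The product of these factors is the
  constant 16 with its power of 2.\<close>

lemma mollify_affine_approx:
  fixes f :: "'a::euclidean_space \<Rightarrow> real"
  assumes f: "continuous_on UNIV f" and "0 < \<delta>"
    and approx: "\<And>u. norm (u - x) < s \<Longrightarrow> \<bar>f u - f x - c \<bullet> (u - x)\<bar> \<le> e"
    and y: "norm (y - x) + \<delta> \<le> s"
  shows "\<bar>mollify \<delta> f y - mollify \<delta> f x - c \<bullet> (y - x)\<bar> \<le> 16 * 2 ^ DIM('a) * e / \<delta> * norm (y - x)"
proof -
  let ?m = "\<integral>u. bump \<delta> (u::'a) \<partial>lborel"
  let ?v = "measure lborel (ball (0::'a) \<delta>)"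
  have m: "0 < ?m" by (rule integral_bump_pos) fact
  have mv: "?v \<le> 2 * 2 ^ DIM('a) * ?m" using integral_bump_lower[OF \<open>0 < \<delta>\<close>, where 'a='a] by (simp add: field_simps)
  have "0 < s" using y norm_ge_zero[of "y - x"] \<open>0 < \<delta>\<close> by linarith
  then have e: "0 \<le> e" using approx[of x] by simp
  define h where "h = (\<lambda>u. f u - f x - c \<bullet> (u - x))"
  define a where "a = (\<lambda>u. f x + c \<bullet> (u - x))"
  have h: "continuous_on UNIV h" unfolding h_def by (intro continuous_intros f)
  have a: "continuous_on UNIV a" unfolding a_def by (intro continuous_intros)
  have fha: "f u = h u + a u" for u by (simp add: h_def a_def)
  have sum: "mollify \<delta> f w = mollify \<delta> h w + mollify \<delta> a w" for w
    unfolding mollify_def fha distrib_right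
    by (simp add: integrable_mult_bump[OF h \<open>0 < \<delta>\<close>] integrable_mult_bump[OF a \<open>0 < \<delta>\<close>] add_divide_distrib)
  have "\<bar>mollify \<delta> a y - mollify \<delta> a x - c \<bullet> (y - x)\<bar> \<le> 0"
    by (rule mollify_diff_le[OF a \<open>0 < \<delta>\<close>]) (simp add: a_def algebra_simps)
  then have A: "mollify \<delta> a y - mollify \<delta> a x = c \<bullet> (y - x)" by simp
  let ?B = "ball x \<delta> \<union> ball y \<delta>"
  have i: "integrable lborel (\<lambda>u. h u * bump \<delta> (w - u))" for w by (rule integrable_mult_bump[OF h \<open>0 < \<delta>\<close>])
  have Bm: "?B \<in> sets lborel" by auto
  have Bv: "measure lborel ?B \<le> 2 * ?v"
    using measure_Un_le[of "ball x \<delta>" lborel "ball y \<delta>"] \<open>0 < \<delta>\<close> by (simp add: content_ball)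
  have Bfin: "emeasure lborel ?B < \<infinity>"
    by (rule emeasure_bounded_finite) auto
  have "(mollify \<delta> h y - mollify \<delta> h x) * ?m = (\<integral>u. h u * bump \<delta> (y - u) - h u * bump \<delta> (x - u) \<partial>lborel)"
    unfolding mollify_def using m i by (simp add: field_simps)
  also have "\<bar>\<dots>\<bar> \<le> (\<integral>u. indicator ?B u * (e * (4 / \<delta> * norm (y - x))) \<partial>lborel)"
  proof (rule integral_abs_bound[THEN order_trans], rule integral_mono)
    show "integrable lborel (\<lambda>u. \<bar>h u * bump \<delta> (y - u) - h u * bump \<delta> (x - u)\<bar>)"
      using i by (intro integrable_abs) auto
    show "integrable lborel (\<lambda>u. indicator ?B u * (e * (4 / \<delta> * norm (y - x))))"
      using Bm Bfin by (intro integrable_mult_left integrable_real_indicator)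
    fix u
    show "\<bar>h u * bump \<delta> (y - u) - h u * bump \<delta> (x - u)\<bar> \<le> indicator ?B u * (e * (4 / \<delta> * norm (y - x)))"
    proof (cases "u \<in> ?B")
      case True
      have "norm (u - x) < s"
      proof (cases "u \<in> ball x \<delta>")
        case True
        then have "norm (u - x) < \<delta>" by (simp add: dist_norm norm_minus_commute)
        then show ?thesis using y norm_ge_zero[of "y - x"] by linarith
      next
        case False
        then have "norm (u - y) < \<delta>" using True by (simp add: dist_norm norm_minus_commute)
        moreover have "norm (u - x) \<le> norm (u - y) + norm (y - x)"
          using norm_triangle_ineq[of "u - y" "y - x"] by simp
        ultimately show ?thesis using y by linarith
      qed
      then have "\<bar>h u\<bar> \<le> e" using approx by (simp add: h_def)
      moreover have "\<bar>bump \<delta> (y - u) - bump \<delta> (x - u)\<bar> \<le> 4 / \<delta> * norm (y - x)"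
        using bump_lipschitz[OF \<open>0 < \<delta>\<close>, of "y - u" "x - u"] by simp
      ultimately have "\<bar>h u\<bar> * \<bar>bump \<delta> (y - u) - bump \<delta> (x - u)\<bar> \<le> e * (4 / \<delta> * norm (y - x))"
        using e by (intro mult_mono) auto
      then show ?thesis using True by (simp add: right_diff_distrib flip: abs_mult)
    next
      case False
      then have "bump \<delta> (x - u) = 0" "bump \<delta> (y - u) = 0"
        by (auto intro!: bump_eq_0 \<open>0 < \<delta>\<close> simp: dist_norm)
      then show ?thesis using False by simp
    qed
  qed
  also have "\<dots> = measure lborel ?B * (e * (4 / \<delta> * norm (y - x)))" by simp
  also have "\<dots> \<le> (4 * 2 ^ DIM('a) * ?m) * (e * (4 / \<delta> * norm (y - x)))"
    using Bv mv e \<open>0 < \<delta>\<close> by (intro mult_right_mono) auto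
  also have "\<dots> = (16 * 2 ^ DIM('a) * e / \<delta> * norm (y - x)) * ?m" by simp
  finally have "\<bar>mollify \<delta> h y - mollify \<delta> h x\<bar> * ?m \<le> (16 * 2 ^ DIM('a) * e / \<delta> * norm (y - x)) * ?m"
    using m by (simp add: abs_mult)
  then have "\<bar>mollify \<delta> h y - mollify \<delta> h x\<bar> \<le> 16 * 2 ^ DIM('a) * e / \<delta> * norm (y - x)"
    using m by (rule mult_right_le_imp_le)
  then show ?thesis using A by (simp add: sum)
qed

section \<open>Approximation of Lipschitz functions by continuously differentiable ones\<close>

text \<open>The extension is the lower envelope of the cones \<open>f x + L * dist z x\<close> with
  apex on the graph over \<open>E\<close>. Each cone is \<open>L\<close>-Lipschitz in
  \<open>z\<close>, and the constant survives the infimum once it is bounded below.\<close>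

lemma mcshane_extension:
  fixes f :: "'a::metric_space \<Rightarrow> real"
  assumes lip: "L-lipschitz_on E f"
  obtains F where "L-lipschitz_on UNIV F" "\<And>x. x \<in> E \<Longrightarrow> F x = f x"
proof (cases "E = {}")
  case True
  then show ?thesis using that[of "\<lambda>_. 0"] lipschitz_on_nonneg[OF lip] by (simp add: lipschitz_on_def)
next
  case False
  have L: "0 \<le> L" using lip by (rule lipschitz_on_nonneg)
  have f: "\<bar>f x - f y\<bar> \<le> L * dist x y" if "x \<in> E" "y \<in> E" for x y
    using lipschitz_onD[OF lip that] by (simp add: dist_real_def)
  define F where "F = (\<lambda>z. INF x\<in>E. f x + L * dist z x)"
  obtain a where a: "a \<in> E" using False by blast
  have bdd: "bdd_below ((\<lambda>x. f x + L * dist z x) ` E)" for z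
  proof (rule bdd_belowI2)
    fix x assume x: "x \<in> E"
    have "f a \<le> f x + L * dist a x" using f[OF a x] by linarith
    also have "L * dist a x \<le> L * (dist z a + dist z x)"
      using L by (intro mult_left_mono dist_triangle3) (metis dist_commute)
    finally show "f a - L * dist z a \<le> f x + L * dist z x" by (simp add: algebra_simps)
  qed
  have le: "F z \<le> F w + L * dist z w" for z w
  proof -
    have "F z - L * dist z w \<le> F w"
      unfolding F_def
    proof (rule cINF_greatest[OF False])
      fix x assume x: "x \<in> E"
      have "(INF x\<in>E. f x + L * dist z x) \<le> f x + L * dist z x" by (rule cINF_lower[OF bdd x])
      also have "L * dist z x \<le> L * (dist z w + dist w x)" using L by (intro mult_left_mono dist_triangle)
      finally show "(INF x\<in>E. f x + L * dist z x) - L * dist z w \<le> f x + L * dist w x" by (simp add: algebra_simps)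
    qed
    then show ?thesis by simp
  qed
  show ?thesis
  proof (rule that)
    show "L-lipschitz_on UNIV F"
    proof (rule lipschitz_onI[OF _ L])
      fix z w show "dist (F z) (F w) \<le> L * dist z w"
        using le[of z w] le[of w z] by (simp add: dist_real_def dist_commute abs_le_iff)
    qed
    fix z assume z: "z \<in> E"
    have "F z \<le> f z + L * dist z z" unfolding F_def by (rule cINF_lower[OF bdd z])
    moreover have "f z \<le> F z" unfolding F_def
    proof (rule cINF_greatest[OF False])
      fix x assume "x \<in> E" then show "f z \<le> f x + L * dist z x" using f[OF z] by (auto simp: abs_le_iff algebra_simps)
    qed
    ultimately show "F z = f z" by simp
  qed
qed

text \<open>Clamping between \<open>-\<phi>\<close> and \<open>\<phi>\<close> keeps the constant
  \<open>L\<close>, which multiplication by a cutoff could increase. The barrier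
  \<open>\<phi>\<close> is itself \<open>L\<close>-Lipschitz, at least \<open>L\<close> on the ball
  of radius \<open>R\<close> and zero from radius \<open>R + 1\<close> on; since \<open>f\<close> is
  bounded by \<open>L\<close>, its values on \<open>E\<close> are untouched.\<close>

lemma lipschitz_extension_bounded_support:
  fixes f :: "'a::euclidean_space \<Rightarrow> real"
  assumes lip: "L-lipschitz_on E f" and E: "E \<subseteq> cball 0 R" and f: "\<And>x. x \<in> E \<Longrightarrow> \<bar>f x\<bar> \<le> L"
  obtains F where "L-lipschitz_on UNIV F" "\<And>x. x \<in> E \<Longrightarrow> F x = f x" "\<And>x. R + 1 \<le> norm x \<Longrightarrow> F x = 0"
proof -
  have L: "0 \<le> L" using lip by (rule lipschitz_on_nonneg)
  obtain G where G: "L-lipschitz_on UNIV G" "\<And>x. x \<in> E \<Longrightarrow> G x = f x" using mcshane_extension[OF lip] by metis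
  define \<phi> where "\<phi> = (\<lambda>x::'a. L * max 0 (R + 1 - norm x))"
  have clamp: "\<bar>max (- p) (min p a) - max (- q) (min q b)\<bar> \<le> d" if "\<bar>a - b\<bar> \<le> d" "\<bar>p - q\<bar> \<le> d" for a b p q d :: real
    using that by (auto simp: min_def max_def abs_if split: if_splits)
  show ?thesis
  proof (rule that)
    show "L-lipschitz_on UNIV (\<lambda>x. max (- \<phi> x) (min (\<phi> x) (G x)))"
    proof (rule lipschitz_onI[OF _ L])
      fix x y :: 'a
      have "\<bar>max 0 (R + 1 - norm x) - max 0 (R + 1 - norm y)\<bar> \<le> dist x y"
        using norm_triangle_ineq3[of x y] by (auto simp: max_def abs_if dist_norm split: if_splits)
      then have "\<bar>\<phi> x - \<phi> y\<bar> \<le> L * dist x y"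
        unfolding \<phi>_def right_diff_distrib[symmetric] abs_mult using L by (auto intro!: mult_mono)
      moreover have "\<bar>G x - G y\<bar> \<le> L * dist x y" using lipschitz_onD[OF G(1), of x y] by (simp add: dist_real_def)
      ultimately show "dist (max (- \<phi> x) (min (\<phi> x) (G x))) (max (- \<phi> y) (min (\<phi> y) (G y))) \<le> L * dist x y"
        unfolding dist_real_def by (intro clamp)
    qed
    fix x assume x: "x \<in> E"
    then have "L * 1 \<le> \<phi> x" unfolding \<phi>_def using E L by (intro mult_left_mono) auto
    then show "max (- \<phi> x) (min (\<phi> x) (G x)) = f x" using f[OF x] G(2)[OF x] by auto
  qed (auto simp: \<phi>_def max_def)
qed

section \<open>Exhaustion in measure and the halving iteration\<close>

lemma measure_Diff_exhaustion:
  fixes E :: "nat \<Rightarrow> 'a::euclidean_space set"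
  assumes A: "A \<in> lmeasurable" and E: "\<And>n. E n \<in> sets lebesgue" "mono E"
    and neg: "negligible (A - (\<Union>n. E n))" and "0 < e"
  obtains n where "A - E n \<in> lmeasurable" "measure lebesgue (A - E n) < e"
proof -
  have m: "A - E n \<in> lmeasurable" for n using A E by (intro fmeasurable_Diff)
  have "(\<lambda>n. measure lebesgue (A - E n)) \<longlonglongrightarrow> measure lebesgue (\<Inter>n. A - E n)"
  proof (rule Lim_measure_decseq)
    show "range (\<lambda>n. A - E n) \<subseteq> sets lebesgue" using m by auto
    show "decseq (\<lambda>n. A - E n)" using \<open>mono E\<close> by (auto simp: decseq_def mono_def)
    show "emeasure lebesgue (A - E n) \<noteq> \<infinity>" for n using fmeasurableD2[OF m] by simp
  qed
  moreover have "(\<Inter>n. A - E n) = A - (\<Union>n. E n)" by auto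
  ultimately have "(\<lambda>n. measure lebesgue (A - E n)) \<longlonglongrightarrow> 0"
    using neg by (simp add: negligible_imp_measure0)
  then have "\<forall>\<^sub>F n in sequentially. measure lebesgue (A - E n) < e"
    using \<open>0 < e\<close> by (rule order_tendstoD)
  then show ?thesis using that m by (auto simp: eventually_sequentially)
qed

lemma measure_geometric_UN_le:
  assumes N: "\<And>n. N n \<in> lmeasurable" "\<And>n. measure lebesgue (N n) \<le> e * (1/2) ^ Suc n" and "0 < e"
  shows "measure lebesgue (\<Union>i\<le>n. N i) \<le> e"
proof -
  have "measure lebesgue (\<Union>i\<le>n. N i) \<le> (\<Sum>i\<le>n. measure lebesgue (N i))"
    using N by (intro measure_UNION_le) auto
  also have "\<dots> \<le> (\<Sum>i\<le>n. e * (1/2) ^ Suc i)" by (intro sum_mono N)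
  also have "\<dots> \<le> (\<Sum>i. e * (1/2) ^ Suc i)"
    using \<open>0 < e\<close> by (intro sum_le_suminf summable_mult sums_summable[OF power_half_series]) auto
  also have "\<dots> = e" using sums_mult[OF power_half_series, of e] by (simp add: sums_iff)
  finally show ?thesis .
qed

text \<open>The remainder vanishes outside the same ball while its constant halves, so the step
  applies to it again. The extension with bounded support asks that the remainder also be at most
  \<open>L/2\<close> in absolute value, which is why \<open>g\<close> must be uniformly close to
  \<open>f\<close>.\<close>

lemma lipschitz_C1_step:
  fixes f :: "'a::euclidean_space \<Rightarrow> real"
  assumes lip: "L-lipschitz_on UNIV f" and "0 < L" and supp: "\<And>x. R + 1 \<le> norm x \<Longrightarrow> f x = 0" and "0 < e"
  obtains g f' N where "C1_UNIV g" "\<And>x y. \<bar>g x - g y\<bar> \<le> L * norm (x - y)" "\<And>x. \<bar>g x - f x\<bar> \<le> L"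
    "(L/2)-lipschitz_on UNIV f'" "\<And>x. R + 1 \<le> norm x \<Longrightarrow> f' x = 0"
    "N \<in> lmeasurable" "measure lebesgue N \<le> e" "\<And>x. x \<in> cball 0 R - N \<Longrightarrow> f x = g x + f' x"
proof -
  define c0 :: real where "c0 = 16 * 2 ^ DIM('a)"
  have c0: "0 \<le> c0" by (simp add: c0_def)
  \<comment> \<open>At short distance the errors of \<open>f\<close> and \<open>g\<close> against
    one affine function have slopes \<open>\<eta>\<close> and \<open>5 * c0 * \<eta>\<close>, which
    add up to exactly \<open>L/2\<close>. The 5 comes from the radius \<open>5 * \<delta>\<close>,
    on which the affine error is at most \<open>\<eta> * (5 * \<delta>)\<close>.\<close>
  define \<eta> where "\<eta> = (L/2) / (5 * c0 + 1)"
  have "0 < 5 * c0 + 1" using c0 by simp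
  then have \<eta>: "0 < \<eta>" "\<eta> * (5 * c0 + 1) = L/2"
    using \<open>0 < L\<close> by (simp add: \<eta>_def, intro nonzero_eq_divide_eq[THEN iffD1]) (auto simp: \<eta>_def)
  have cont: "continuous_on UNIV f" using lip by (rule lipschitz_on_continuous_on)
  obtain C :: "'a set" where C: "countable C"
    "negligible {x. \<not> (\<exists>c\<in>C. \<exists>m. \<forall>y. norm (y - x) < inverse (real (Suc m)) \<longrightarrow> \<bar>f y - f x - c \<bullet> (y - x)\<bar> \<le> \<eta> * norm (y - x))}"
    by (rule lipschitz_ae_approx_linear[OF lip \<eta>(1)])
  define E where "E = (\<lambda>m. \<Union>c\<in>C. {x. \<forall>y. norm (y - x) < inverse (real (Suc m)) \<longrightarrow> \<bar>f y - f x - c \<bullet> (y - x)\<bar> \<le> \<eta> * norm (y - x)})"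
  have "closed {x. \<forall>y. norm (y - x) < inverse (real (Suc m)) \<longrightarrow> \<bar>f y - f x - c \<bullet> (y - x)\<bar> \<le> \<eta> * norm (y - x)}" for m c
    by (intro closed_Collect_all closed_Collect_imp open_Collect_less closed_Collect_le continuous_intros cont)
  then have "E m \<in> sets borel" for m
    unfolding E_def by (intro sets.countable_UN'[OF C(1)] image_subsetI borel_closed)
  then have E: "E m \<in> sets lebesgue" for m by simp
  have "mono E"
  proof (rule monoI)
    fix m n :: nat assume "m \<le> n"
    then have "inverse (real (Suc n)) \<le> inverse (real (Suc m))" by simp
    then have "norm (y - x) < inverse (real (Suc n)) \<Longrightarrow> norm (y - x) < inverse (real (Suc m))" for x y :: 'a by linarith
    then show "E m \<subseteq> E n" unfolding E_def by blast
  qed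
  have "negligible (cball 0 R - (\<Union>m. E m))"
    by (rule negligible_subset[OF C(2)]) (auto simp: E_def)
  from measure_Diff_exhaustion[OF lmeasurable_cball E \<open>mono E\<close> this \<open>0 < e\<close>]
  obtain m where m: "cball 0 R - E m \<in> lmeasurable" "measure lebesgue (cball 0 R - E m) < e" .
  \<comment> \<open>The cap \<open>1/2\<close> makes \<open>f - g\<close> at most
    \<open>L/2\<close>. The divisor 6 puts \<open>5 * \<delta>\<close> strictly below the scale of
    \<open>E m\<close>: \<open>4 * \<delta>\<close> for near pairs plus \<open>\<delta>\<close> for
    the kernel.\<close>
  define \<delta> where "\<delta> = min (1/2) (inverse (real (Suc m)) / 6)"
  have \<delta>: "0 < \<delta>" "\<delta> \<le> 1/2" "5 * \<delta> < inverse (real (Suc m))"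
    by (auto simp: \<delta>_def min_def field_simps)
  define g where "g = mollify \<delta> f"
  have close: "\<bar>g x - f x\<bar> \<le> L * \<delta>" for x unfolding g_def by (rule mollify_close[OF lip \<delta>(1)])
  have L\<delta>: "L * \<delta> \<le> L / 2" using \<delta> \<open>0 < L\<close> mult_left_mono[of \<delta> "1/2" L] by simp
  let ?K = "cball 0 R \<inter> E m"
  \<comment> \<open>Beyond distance \<open>4 \<delta>\<close> uniform closeness of \<open>f\<close> and \<open>g\<close> suffices; below it, both are close to
    the same affine function.\<close>
  have fg: "\<bar>(f x - g x) - (f y - g y)\<bar> \<le> L/2 * norm (x - y)" if xK: "x \<in> ?K" for x y
  proof (cases "norm (y - x) < 4 * \<delta>")
    case True
    obtain c where "\<forall>u. norm (u - x) < inverse (real (Suc m)) \<longrightarrow> \<bar>f u - f x - c \<bullet> (u - x)\<bar> \<le> \<eta> * norm (u - x)"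
      using xK unfolding E_def by blast
    then have c: "\<bar>f u - f x - c \<bullet> (u - x)\<bar> \<le> \<eta> * norm (u - x)" if "norm (u - x) < inverse (real (Suc m))" for u
      using that by blast
    have "\<bar>g y - g x - c \<bullet> (y - x)\<bar> \<le> 16 * 2 ^ DIM('a) * (\<eta> * (5 * \<delta>)) / \<delta> * norm (y - x)"
      unfolding g_def
    proof (rule mollify_affine_approx[OF cont \<delta>(1)])
      fix u assume u: "norm (u - x) < 5 * \<delta>"
      have "\<bar>f u - f x - c \<bullet> (u - x)\<bar> \<le> \<eta> * norm (u - x)" using u \<delta> by (intro c) linarith
      also have "\<dots> \<le> \<eta> * (5 * \<delta>)" using u \<eta> by (intro mult_left_mono) auto
      finally show "\<bar>f u - f x - c \<bullet> (u - x)\<bar> \<le> \<eta> * (5 * \<delta>)" .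
    qed (use True in linarith)
    also have "\<dots> = 5 * c0 * \<eta> * norm (y - x)" using \<delta> by (simp add: c0_def)
    finally have 1: "\<bar>g y - g x - c \<bullet> (y - x)\<bar> \<le> 5 * c0 * \<eta> * norm (y - x)" .
    have 2: "\<bar>f y - f x - c \<bullet> (y - x)\<bar> \<le> \<eta> * norm (y - x)" using True \<delta> by (intro c) linarith
    have 3: "L/2 * norm (x - y) = \<eta> * norm (y - x) + 5 * c0 * \<eta> * norm (y - x)"
      by (simp add: \<eta>(2)[symmetric] norm_minus_commute algebra_simps)
    show ?thesis unfolding 3 using 1 2 by linarith
  next
    case False
    have "\<bar>(f x - g x) - (f y - g y)\<bar> \<le> 2 * (L * \<delta>)" using close[of x] close[of y] by linarith
    also have "\<dots> = L/2 * (4 * \<delta>)" by simp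
    also have "\<dots> \<le> L/2 * norm (x - y)"
      using False \<open>0 < L\<close> by (intro mult_left_mono) (auto simp: norm_minus_commute)
    finally show ?thesis .
  qed
  have "(L/2)-lipschitz_on ?K (\<lambda>x. f x - g x)"
    by (rule lipschitz_onI) (use fg \<open>0 < L\<close> in \<open>auto simp: dist_norm\<close>)
  moreover have "\<bar>f x - g x\<bar> \<le> L/2" for x using close[of x] L\<delta> by linarith
  ultimately obtain f' where f': "(L/2)-lipschitz_on UNIV f'" "\<And>x. x \<in> ?K \<Longrightarrow> f' x = f x - g x"
      "\<And>x. R + 1 \<le> norm x \<Longrightarrow> f' x = 0"
    using lipschitz_extension_bounded_support[of "L/2" ?K "\<lambda>x. f x - g x" R] by (metis Int_lower1)
  show ?thesis
  proof (rule that[of g f' "cball 0 R - E m"])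
    show "C1_UNIV g" unfolding g_def by (rule mollify_C1[OF cont supp \<delta>(1)])
    show "\<bar>g x - g y\<bar> \<le> L * norm (x - y)" for x y unfolding g_def by (rule mollify_lipschitz[OF lip \<delta>(1)])
    show "\<bar>g x - f x\<bar> \<le> L" for x using close[of x] L\<delta> \<open>0 < L\<close> by linarith
    show "f x = g x + f' x" if "x \<in> cball 0 R - (cball 0 R - E m)" for x using that f'(2)[of x] by auto
  qed (use f' m in auto)
qed

lemma norm_derivative_le_lipschitz:
  fixes g :: "'a::real_normed_vector \<Rightarrow> real"
  assumes D: "(g has_derivative blinfun_apply D) (at x)" and lip: "\<And>y. \<bar>g y - g x\<bar> \<le> L * norm (y - x)" and "0 \<le> L"
  shows "norm D \<le> L"
proof (rule norm_blinfun_bound[OF \<open>0 \<le> L\<close>])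
  fix h
  have "((\<lambda>t. g (x + t *\<^sub>R h)) has_derivative (\<lambda>t. D (t *\<^sub>R h))) (at 0)"
    by (rule has_derivative_compose[of "\<lambda>t. x + t *\<^sub>R h"]) (auto intro!: derivative_eq_intros D)
  then have "((\<lambda>t. g (x + t *\<^sub>R h)) has_real_derivative D h) (at 0)"
    unfolding has_field_derivative_def
    by (rule has_derivative_eq_rhs) (simp add: fun_eq_iff blinfun.scaleR_right)
  then have "((\<lambda>t. \<bar>(g (x + t *\<^sub>R h) - g x) / t\<bar>) \<longlongrightarrow> \<bar>D h\<bar>) (at 0)"
    unfolding DERIV_def by (intro tendsto_rabs) simp
  moreover have "\<forall>\<^sub>F t in at 0. \<bar>(g (x + t *\<^sub>R h) - g x) / t\<bar> \<le> L * norm h"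
  proof -
    have "\<bar>(g (x + t *\<^sub>R h) - g x) / t\<bar> \<le> L * norm h" if "t \<noteq> 0" for t
      using lip[of "x + t *\<^sub>R h"] that by (simp add: field_simps)
    then show ?thesis by (auto simp: eventually_at intro!: exI[of _ 1])
  qed
  ultimately have "\<bar>D h\<bar> \<le> L * norm h" by (rule tendsto_upperbound) simp
  then show "norm (blinfun_apply D h) \<le> L * norm h" by simp
qed

lemma C1_suminf:
  fixes g :: "nat \<Rightarrow> 'a::euclidean_space \<Rightarrow> real"
  assumes C1: "\<And>i. C1_UNIV (g i)" and lip: "\<And>i x y. \<bar>g i x - g i y\<bar> \<le> M i * norm (x - y)"
    and bound: "\<And>i x. \<bar>g i x\<bar> \<le> B * M i" and M: "summable M" "\<And>i. 0 \<le> M i"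
  shows "C1_UNIV (\<lambda>x. \<Sum>i. g i x)"
proof -
  have sum: "summable (\<lambda>i. g i x)" for x
    by (rule summable_comparison_test'[OF summable_mult[OF M(1)], of 0 _ B]) (use bound in auto)
  obtain D where D: "\<And>i x. (g i has_derivative blinfun_apply (D i x)) (at x)" "\<And>i. continuous_on UNIV (D i)"
    using C1 unfolding C1_UNIV_def by metis
  have normD: "norm (D i x) \<le> M i" for i x
    by (rule norm_derivative_le_lipschitz[OF D(1)]) (use lip M in auto)
  have ul: "uniform_limit UNIV (\<lambda>n x. \<Sum>i<n. D i x) (\<lambda>x. \<Sum>i. D i x) sequentially"
    by (rule Weierstrass_m_test) (use normD M in auto)
  have cont: "continuous_on UNIV (\<lambda>x. \<Sum>i. D i x)"
    by (rule uniform_limit_theorem[OF _ ul]) (auto intro!: always_eventually continuous_intros D(2))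
  have "\<exists>G. \<forall>x\<in>UNIV. (\<lambda>n. g n x) sums (G x) \<and> (G has_derivative blinfun_apply (\<Sum>i. D i x)) (at x within UNIV)"
  proof (rule has_derivative_series)
    fix e :: real assume "0 < e"
    have "\<forall>\<^sub>F n in sequentially. \<forall>x\<in>UNIV. dist (\<Sum>i<n. D i x) (\<Sum>i. D i x) < e"
      using ul \<open>0 < e\<close> by (rule uniform_limitD)
    then show "\<forall>\<^sub>F n in sequentially. \<forall>x\<in>UNIV. \<forall>h. norm ((\<Sum>i<n. blinfun_apply (D i x) h) - blinfun_apply (\<Sum>i. D i x) h) \<le> e * norm h"
    proof eventually_elim
      case (elim n)
      have "norm ((\<Sum>i<n. D i x h) - (\<Sum>i. D i x) h) \<le> e * norm h" for x h
      proof -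
        have "(\<Sum>i<n. D i x h) - (\<Sum>i. D i x) h = ((\<Sum>i<n. D i x) - (\<Sum>i. D i x)) h"
          by (simp add: blinfun.diff_left blinfun.sum_left)
        also have "norm \<dots> \<le> norm ((\<Sum>i<n. D i x) - (\<Sum>i. D i x)) * norm h" by (rule norm_blinfun)
        also have "\<dots> \<le> e * norm h" using elim by (intro mult_right_mono) (auto simp: dist_norm less_imp_le)
        finally show ?thesis .
      qed
      then show ?case by blast
    qed
  qed (use D(1) sum summable_sums in auto)
  then obtain G where G: "\<And>x. (\<lambda>n. g n x) sums G x" "\<And>x. (G has_derivative blinfun_apply (\<Sum>i. D i x)) (at x)" by auto
  have "G = (\<lambda>x. \<Sum>i. g i x)" using G(1) sums_unique by blast
  then show ?thesis
    unfolding C1_UNIV_def using G(2) cont by (intro exI[of _ "\<lambda>x. \<Sum>i. D i x"]) simp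
qed

text \<open>Off the exceptional sets \<open>f\<close> is a partial sum of the \<open>g i\<close>
  plus the remainder \<open>F n\<close>. The remainder tends to zero uniformly, since its constant
  is \<open>L / 2 ^ n\<close> and it vanishes outside a fixed ball.\<close>

lemma lipschitz_bounded_support_C1:
  fixes f :: "'a::euclidean_space \<Rightarrow> real"
  assumes lip: "L-lipschitz_on UNIV f" and "0 < L" and supp: "\<And>x. R + 1 \<le> norm x \<Longrightarrow> f x = 0" and "0 < e" and "0 \<le> R"
  obtains G N where "C1_UNIV G" "N \<in> lmeasurable" "measure lebesgue N \<le> e" "\<And>x. x \<in> cball 0 R - N \<Longrightarrow> f x = G x"
proof -
  define P where "P = (\<lambda>n (h :: 'a \<Rightarrow> real). (L / 2 ^ n)-lipschitz_on UNIV h \<and> (\<forall>x. R + 1 \<le> norm x \<longrightarrow> h x = 0))"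
  define Q where "Q = (\<lambda>n (h :: 'a \<Rightarrow> real) h' g N. C1_UNIV g \<and> (\<forall>x y. \<bar>g x - g y\<bar> \<le> L / 2 ^ n * norm (x - y)) \<and> (\<forall>x. \<bar>g x - h x\<bar> \<le> L / 2 ^ n)
     \<and> N \<in> lmeasurable \<and> measure lebesgue N \<le> e * (1/2) ^ Suc n \<and> (\<forall>x\<in>cball 0 R - N. h x = g x + h' x))"
  have step: "\<exists>h'. P (Suc n) h' \<and> (\<exists>g N. Q n h h' g N)" if "P n h" for n h
  proof -
    have h: "(L / 2 ^ n)-lipschitz_on UNIV h" "\<And>x. R + 1 \<le> norm x \<Longrightarrow> h x = 0" using that by (auto simp: P_def)
    have "0 < L / 2 ^ n" "0 < e * (1/2) ^ Suc n" using \<open>0 < L\<close> \<open>0 < e\<close> by auto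
    from lipschitz_C1_step[OF h(1) this(1) h(2) this(2)]
    obtain g h' N where "C1_UNIV g" "\<And>x y. \<bar>g x - g y\<bar> \<le> L / 2 ^ n * norm (x - y)" "\<And>x. \<bar>g x - h x\<bar> \<le> L / 2 ^ n"
      "(L / 2 ^ n / 2)-lipschitz_on UNIV h'" "\<And>x. R + 1 \<le> norm x \<Longrightarrow> h' x = 0"
      "N \<in> lmeasurable" "measure lebesgue N \<le> e * (1/2) ^ Suc n" "\<And>x. x \<in> cball 0 R - N \<Longrightarrow> h x = g x + h' x"
      by metis
    then show ?thesis unfolding P_def Q_def by (intro exI[of _ h'] conjI exI[of _ g] exI[of _ N]) (auto simp: mult.commute)
  qed
  have "P 0 f" using lip supp by (simp add: P_def)
  \<comment> \<open>The clause for \<open>n = 0\<close> belongs to the invariant because the choice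
    principle does not fix where the sequence starts.\<close>
  have "\<exists>F. \<forall>n. (P n (F n) \<and> (n = 0 \<longrightarrow> F n = f)) \<and> (\<exists>g N. Q n (F n) (F (Suc n)) g N)"
    by (rule dependent_nat_choice) (use \<open>P 0 f\<close> step in auto)
  then obtain F where F: "F 0 = f" "\<And>n. P n (F n)" "\<And>n. \<exists>g N. Q n (F n) (F (Suc n)) g N"
    by auto
  obtain g N where Q: "\<And>n. Q n (F n) (F (Suc n)) (g n) (N n)" using F(3) by metis
  \<comment> \<open>Twice the radius \<open>R + 1\<close>: every point of that ball is within this
    distance of \<open>(R + 1) *\<^sub>R b\<close>, where \<open>F n\<close> vanishes.\<close>
  define T where "T = 2 * R + 2"
  have Fb: "\<bar>F n x\<bar> \<le> T * (L / 2 ^ n)" for n x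
  proof (cases "R + 1 \<le> norm x")
    case False
    obtain b :: 'a where b: "b \<in> Basis" using nonempty_Basis by blast
    let ?y = "(R + 1) *\<^sub>R b"
    have y: "norm ?y = R + 1" using b \<open>0 \<le> R\<close> by simp
    then have "F n ?y = 0" using F(2)[of n] by (simp add: P_def)
    then have "\<bar>F n x\<bar> \<le> L / 2 ^ n * norm (x - ?y)"
      using lipschitz_onD[of "L / 2 ^ n" UNIV "F n" x ?y] F(2)[of n] by (simp add: P_def dist_norm)
    also have "norm (x - ?y) \<le> T" using norm_triangle_ineq4[of x ?y] y False by (simp add: T_def)
    finally show ?thesis using \<open>0 < L\<close> by (simp add: mult.commute divide_right_mono)
  qed (use F(2)[of n] \<open>0 < L\<close> \<open>0 \<le> R\<close> in \<open>simp add: P_def T_def\<close>)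
  have gb: "\<bar>g n x\<bar> \<le> (T + 1) * (L / 2 ^ n)" for n x
  proof -
    have "\<bar>g n x - F n x\<bar> \<le> L / 2 ^ n" using Q[of n] by (simp add: Q_def)
    moreover have "(T + 1) * (L / 2 ^ n) = T * (L / 2 ^ n) + L / 2 ^ n" by (simp only: distrib_right mult_1)
    ultimately show ?thesis using Fb[of n x] by linarith
  qed
  have sumL: "summable (\<lambda>n. L / 2 ^ n)"
    using summable_mult[OF summable_geometric[of "1/2::real"], of L] by (simp add: power_divide)
  have G: "C1_UNIV (\<lambda>x. \<Sum>i. g i x)"
    by (rule C1_suminf[where M = "\<lambda>n. L / 2 ^ n" and B = "T + 1"]) (use Q gb sumL \<open>0 < L\<close> in \<open>auto simp: Q_def\<close>)
  have Nm: "\<And>n. N n \<in> lmeasurable" "\<And>n. measure lebesgue (N n) \<le> e * (1/2) ^ Suc n" using Q by (auto simp: Q_def)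
  have Nb: "measure lebesgue (\<Union>i\<le>n. N i) \<le> e" for n
    by (rule measure_geometric_UN_le[OF Nm \<open>0 < e\<close>])
  show ?thesis
  proof (rule that[OF G])
    show "(\<Union>n. N n) \<in> lmeasurable" by (rule fmeasurable_countable_Union[OF Nm(1) Nb])
    show "measure lebesgue (\<Union>n. N n) \<le> e" by (rule measure_countable_Union_le[OF Nm(1) Nb])
    fix x assume x: "x \<in> cball 0 R - (\<Union>n. N n)"
    have tele: "f x = (\<Sum>i<n. g i x) + F n x" for n
    proof (induction n)
      case (Suc n)
      have "F n x = g n x + F (Suc n) x" using Q[of n] x by (auto simp: Q_def)
      then show ?case using Suc by simp
    qed (simp add: F)
    have "(\<lambda>n. T * (L / 2 ^ n)) \<longlonglongrightarrow> 0" using tendsto_mult_right_zero[OF summable_LIMSEQ_zero[OF sumL]] .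
    then have "(\<lambda>n. F n x) \<longlonglongrightarrow> 0"
      by (rule Lim_null_comparison[rotated]) (use Fb in \<open>auto intro!: always_eventually\<close>)
    then have "(\<lambda>n. f x - F n x) \<longlonglongrightarrow> f x - 0" by (intro tendsto_intros)
    moreover have "f x - F n x = (\<Sum>i<n. g i x)" for n using tele[of n] by simp
    ultimately have "(\<lambda>i. g i x) sums f x" by (simp add: sums_def)
    then show "f x = (\<Sum>i. g i x)" by (rule sums_unique)
  qed
qed

lemma lipschitz_on_bounded_C1:
  fixes f :: "'a::euclidean_space \<Rightarrow> real"
  assumes lip: "M-lipschitz_on E f" and "bounded E" and "0 < e"
  obtains G N where "C1_UNIV G" "N \<in> lmeasurable" "measure lebesgue N \<le> e" "\<And>x. x \<in> E - N \<Longrightarrow> f x = G x"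
proof -
  obtain R where "0 < R" "\<forall>x\<in>E. norm x \<le> R" using \<open>bounded E\<close> bounded_pos by blast
  then have R: "0 < R" "E \<subseteq> cball 0 R" by auto
  have "bounded (f ` E)"
    using bounded_uniformly_continuous_image[OF lipschitz_on_uniformly_continuous[OF lip] \<open>bounded E\<close>] .
  then obtain B where B: "\<And>x. x \<in> E \<Longrightarrow> \<bar>f x\<bar> \<le> B" unfolding bounded_iff by auto
  \<comment> \<open>\<open>B\<close> enters because the extension needs values bounded by its
    constant, and 1 because the iteration needs a positive constant.\<close>
  define L where "L = max 1 (max M B)"
  have L: "0 < L" "M \<le> L" "B \<le> L" by (auto simp: L_def)
  have "L-lipschitz_on E f" using lip L by (auto intro: lipschitz_on_mono)
  moreover have "\<bar>f x\<bar> \<le> L" if "x \<in> E" for x using B[OF that] L by linarith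
  ultimately obtain F where F: "L-lipschitz_on UNIV F" "\<And>x. x \<in> E \<Longrightarrow> F x = f x" "\<And>x. R + 1 \<le> norm x \<Longrightarrow> F x = 0"
    using lipschitz_extension_bounded_support R(2) by metis
  obtain G N where G: "C1_UNIV G" "N \<in> lmeasurable" "measure lebesgue N \<le> e" "\<And>x. x \<in> cball 0 R - N \<Longrightarrow> F x = G x"
    using lipschitz_bounded_support_C1[OF F(1) L(1) F(3) \<open>0 < e\<close> less_imp_le[OF R(1)]] by metis
  show ?thesis
    by (rule that[OF G(1-3)]) (use G(4) F(2) R in force)
qed

section \<open>Gluing, and functions with lower derivate bounded below\<close>

lemma C1_UNIV_I:
  assumes "continuous_on UNIV D" "\<And>x. (g has_derivative blinfun_apply (D x)) (at x)"
  shows "C1_UNIV g"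
  using assms unfolding C1_UNIV_def by blast

lemma C1_UNIV_local:
  fixes g :: "'a::euclidean_space \<Rightarrow> real"
  assumes "\<And>x. \<exists>U h. open U \<and> x \<in> U \<and> C1_UNIV h \<and> (\<forall>y\<in>U. g y = h y)"
  shows "C1_UNIV g"
proof -
  have local: "\<exists>U D. open U \<and> x \<in> U \<and> continuous_on UNIV D \<and> (\<forall>y\<in>U. (g has_derivative blinfun_apply (D y)) (at y))" for x
  proof -
    obtain U h D where U: "open U" "x \<in> U" "\<forall>y\<in>U. g y = h y"
      and D: "\<And>x. (h has_derivative blinfun_apply (D x)) (at x)" "continuous_on UNIV D"
      using assms[of x] unfolding C1_UNIV_def by metis
    have "(g has_derivative blinfun_apply (D y)) (at y)" if "y \<in> U" for y
      by (rule has_derivative_transform_within_open[OF D(1) \<open>open U\<close> that]) (use U in auto)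
    then show ?thesis using U D by blast
  qed
  then have "\<exists>D. (g has_derivative blinfun_apply D) (at x)" for x by blast
  then obtain D where D: "\<And>x. (g has_derivative blinfun_apply (D x)) (at x)" by metis
  have "isCont D x" for x
  proof -
    obtain U D' where U: "open U" "x \<in> U" "continuous_on UNIV D'" "\<forall>y\<in>U. (g has_derivative blinfun_apply (D' y)) (at y)"
      using local by blast
    have eq: "D' y = D y" if "y \<in> U" for y
      using has_derivative_unique[of g "blinfun_apply (D' y)" y "blinfun_apply (D y)"] D U(4) that
      by (simp add: blinfun_apply_inject)
    have "isCont D' x" using U(3) by (simp add: continuous_on_eq_continuous_at)
    then show ?thesis
      by (rule isCont_cong[THEN iffD1, rotated]) (use U eq in \<open>auto simp: eventually_nhds\<close>)
  qed
  then show ?thesis unfolding C1_UNIV_def using D by (intro exI[of _ D]) (auto intro: continuous_at_imp_continuous_on)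
qed

lemma C1_UNIV_mult:
  assumes "C1_UNIV f" "C1_UNIV g"
  shows "C1_UNIV (\<lambda>x. f x * g x)"
proof -
  obtain D E where D: "\<And>x. (f has_derivative blinfun_apply (D x)) (at x)" "continuous_on UNIV D"
    and E: "\<And>x. (g has_derivative blinfun_apply (E x)) (at x)" "continuous_on UNIV E"
    using assms unfolding C1_UNIV_def by blast
  have "continuous_on UNIV f" "continuous_on UNIV g"
    using D E has_derivative_continuous by (blast intro: continuous_at_imp_continuous_on)+
  then have "continuous_on UNIV (\<lambda>x. f x *\<^sub>R E x + g x *\<^sub>R D x)"
    by (intro continuous_intros D E)
  moreover have "((\<lambda>x. f x * g x) has_derivative blinfun_apply (f x *\<^sub>R E x + g x *\<^sub>R D x)) (at x)" for x
    using has_derivative_mult[OF D(1) E(1), of x]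
    by (rule has_derivative_eq_rhs) (auto simp: blinfun.add_left blinfun.scaleR_left)
  ultimately show ?thesis by (rule C1_UNIV_I)
qed

lemma C1_UNIV_sum:
  assumes "\<And>i. i \<in> I \<Longrightarrow> C1_UNIV (f i)"
  shows "C1_UNIV (\<lambda>x. \<Sum>i\<in>I. f i x)"
proof -
  obtain D where D: "\<And>i x. i \<in> I \<Longrightarrow> (f i has_derivative blinfun_apply (D i x)) (at x)" "\<And>i. i \<in> I \<Longrightarrow> continuous_on UNIV (D i)"
    using assms unfolding C1_UNIV_def by metis
  have "continuous_on UNIV (\<lambda>x. \<Sum>i\<in>I. D i x)" by (intro continuous_intros D(2))
  moreover have "((\<lambda>x. \<Sum>i\<in>I. f i x) has_derivative blinfun_apply (\<Sum>i\<in>I. D i x)) (at x)" for x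
    by (rule has_derivative_eq_rhs[OF has_derivative_sum[OF D(1)]]) (auto simp: blinfun.sum_left)
  ultimately show ?thesis by (rule C1_UNIV_I)
qed

text \<open>Unlike the norm, its square is smooth at the origin; this is why the shells are cut out
  by \<open>x \<bullet> x\<close>.\<close>

lemma C1_UNIV_radial:
  fixes w :: "real \<Rightarrow> real"
  assumes w: "\<And>t. (w has_real_derivative w' t) (at t)" "continuous_on UNIV w'"
  shows "C1_UNIV (\<lambda>x::'a::euclidean_space. w (x \<bullet> x))"
proof -
  let ?D = "\<lambda>x::'a. (2 * w' (x \<bullet> x)) *\<^sub>R blinfun_inner_right x"
  have "continuous_on UNIV ?D"
    by (intro continuous_intros continuous_on_compose2[OF w(2)] bounded_linear.continuous_on[OF bounded_linear_blinfun_inner_right]) auto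
  moreover have "((\<lambda>x. w (x \<bullet> x)) has_derivative blinfun_apply (?D x)) (at x)" for x
  proof -
    have "((\<lambda>x. x \<bullet> x) has_derivative (\<lambda>h. 2 * (x \<bullet> h))) (at x)"
      by (auto intro!: derivative_eq_intros simp: inner_commute)
    from has_derivative_compose[OF this w(1)[unfolded has_field_derivative_def]]
    show ?thesis by (rule has_derivative_eq_rhs) (auto simp: fun_eq_iff blinfun.scaleR_left)
  qed
  ultimately show ?thesis by (rule C1_UNIV_I)
qed

definition smooth_step :: "real \<Rightarrow> real" where
  "smooth_step t = 1 - (max 0 (1 - (max 0 t)\<^sup>2))\<^sup>2"

lemma smooth_step_eq_0: "t \<le> 0 \<Longrightarrow> smooth_step t = 0"
  by (simp add: smooth_step_def)

lemma smooth_step_eq_1: "1 \<le> t \<Longrightarrow> smooth_step t = 1"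
  using one_le_power[of t 2] by (simp add: smooth_step_def)

lemma smooth_step_has_derivative:
  "(smooth_step has_real_derivative 4 * max 0 (1 - (max 0 t)\<^sup>2) * max 0 t) (at t)"
proof -
  have "((\<lambda>t. 1 - (max 0 t)\<^sup>2) has_real_derivative - (2 * max 0 t)) (at t)"
    by (rule derivative_eq_intros has_real_derivative_max0_power2 refl | simp)+
  from DERIV_chain2[OF has_real_derivative_max0_power2 this]
  have "((\<lambda>t. 1 - (max 0 (1 - (max 0 t)\<^sup>2))\<^sup>2) has_real_derivative 0 - 2 * max 0 (1 - (max 0 t)\<^sup>2) * - (2 * max 0 t)) (at t)"
    by (intro DERIV_diff DERIV_const)
  then show ?thesis unfolding smooth_step_def[abs_def] by (simp add: mult_ac)
qed

lemma C1_shell_cutoff: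
  fixes m :: nat
  assumes "0 < s"
  obtains \<psi> :: "'a::euclidean_space \<Rightarrow> real" where "C1_UNIV \<psi>"
    "\<And>x. x \<bullet> x \<le> real m \<Longrightarrow> \<psi> x = 0" "\<And>x. real m + 1 \<le> x \<bullet> x \<Longrightarrow> \<psi> x = 0"
    "\<And>x. real m + s \<le> x \<bullet> x \<Longrightarrow> x \<bullet> x \<le> real m + 1 - s \<Longrightarrow> \<psi> x = 1"
proof -
  have C1: "C1_UNIV (\<lambda>x::'a. smooth_step ((a * (x \<bullet> x) + b) / s))" for a b
  proof (rule C1_UNIV_radial)
    let ?u = "\<lambda>t. (a * t + b) / s"
    show "((\<lambda>t. smooth_step (?u t)) has_real_derivative
        (4 * max 0 (1 - (max 0 (?u t))\<^sup>2) * max 0 (?u t)) * (a / s)) (at t)" for t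
      by (rule DERIV_chain2[OF smooth_step_has_derivative]) (use assms in \<open>auto intro!: derivative_eq_intros\<close>)
    show "continuous_on UNIV (\<lambda>t. (4 * max 0 (1 - (max 0 (?u t))\<^sup>2) * max 0 (?u t)) * (a / s))"
      using assms by (auto intro!: continuous_intros)
  qed
  \<comment> \<open>One factor rises while \<open>x \<bullet> x\<close> goes from \<open>m\<close>
    to \<open>m + s\<close>, the other falls between \<open>m + 1 - s\<close> and
    \<open>m + 1\<close>. The coefficients 1 and -1 are spelled out so that both factors are
    instances of the form treated in \<open>C1\<close>.\<close>
  define \<psi> where "\<psi> = (\<lambda>x::'a. smooth_step ((1 * (x \<bullet> x) + (- real m)) / s) * smooth_step (((-1) * (x \<bullet> x) + (real m + 1)) / s))"
  show ?thesis
  proof (rule that)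
    show "C1_UNIV \<psi>" unfolding \<psi>_def by (intro C1_UNIV_mult C1)
    show "\<psi> x = 0" if "x \<bullet> x \<le> real m" for x
    proof -
      have "(1 * (x \<bullet> x) + (- real m)) / s \<le> 0" using that assms by (simp add: divide_le_0_iff)
      then show ?thesis by (simp only: \<psi>_def smooth_step_eq_0 mult_zero_left)
    qed
    show "\<psi> x = 0" if "real m + 1 \<le> x \<bullet> x" for x
    proof -
      have "((-1) * (x \<bullet> x) + (real m + 1)) / s \<le> 0" using that assms by (simp add: divide_le_0_iff)
      then show ?thesis by (simp only: \<psi>_def smooth_step_eq_0 mult_zero_right)
    qed
    show "\<psi> x = 1" if "real m + s \<le> x \<bullet> x" "x \<bullet> x \<le> real m + 1 - s" for x
    proof -
      have "1 \<le> (1 * (x \<bullet> x) + (- real m)) / s" "1 \<le> ((-1) * (x \<bullet> x) + (real m + 1)) / s"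
        using that assms by simp_all
      then show ?thesis by (simp only: \<psi>_def smooth_step_eq_1 mult_1)
    qed
  qed
qed

text \<open>Each \<open>G m\<close> vanishes outside an open shell, so on a bounded set only
  finitely many terms are nonzero and the sum is C1 locally. At a point of a shell only the term of
  that shell can survive.\<close>

lemma C1_glue_shells:
  fixes G :: "nat \<Rightarrow> 'a::euclidean_space \<Rightarrow> real"
  assumes C1: "\<And>m. C1_UNIV (G m)"
    and low: "\<And>m x. x \<bullet> x \<le> real m \<Longrightarrow> G m x = 0" and upp: "\<And>m x. real m + 1 \<le> x \<bullet> x \<Longrightarrow> G m x = 0"
  shows "\<exists>g. C1_UNIV g \<and> (\<forall>m x. real m \<le> x \<bullet> x \<longrightarrow> x \<bullet> x < real m + 1 \<longrightarrow> g x = G m x)"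
proof -
  define g where "g = (\<lambda>x::'a. \<Sum>m\<le>nat \<lfloor>x \<bullet> x\<rfloor>. G m x)"
  have g: "g x = (\<Sum>m\<le>M. G m x)" if "x \<bullet> x < real M + 1" for x M
    unfolding g_def
  proof (rule sum.mono_neutral_left)
    show "{..nat \<lfloor>x \<bullet> x\<rfloor>} \<subseteq> {..M}" using that by (auto simp: nat_le_iff floor_le_iff)
    show "\<forall>m\<in>{..M} - {..nat \<lfloor>x \<bullet> x\<rfloor>}. G m x = 0"
    proof
      fix m assume "m \<in> {..M} - {..nat \<lfloor>x \<bullet> x\<rfloor>}"
      then have "nat \<lfloor>x \<bullet> x\<rfloor> < m" by simp
      then have "x \<bullet> x \<le> real m" by (simp add: nat_less_iff floor_less_iff less_imp_le)
      then show "G m x = 0" by (rule low)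
    qed
  qed simp
  show ?thesis
  proof (intro exI conjI allI impI)
    show "C1_UNIV g"
    proof (rule C1_UNIV_local)
      fix x :: 'a
      obtain M where M: "x \<bullet> x < real M" using reals_Archimedean2 by blast
      have "open {y::'a. y \<bullet> y < real M + 1}" by (intro open_Collect_less continuous_intros)
      moreover have "C1_UNIV (\<lambda>y. \<Sum>m\<le>M. G m y)" by (intro C1_UNIV_sum C1)
      ultimately show "\<exists>U h. open U \<and> x \<in> U \<and> C1_UNIV h \<and> (\<forall>y\<in>U. g y = h y)"
        using M g by (intro exI[of _ "{y. y \<bullet> y < real M + 1}"] exI[of _ "\<lambda>y. \<Sum>m\<le>M. G m y"]) auto
    qed
    fix m and x :: 'a assume x: "real m \<le> x \<bullet> x" "x \<bullet> x < real m + 1"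
    have "g x = (\<Sum>i\<le>m. G i x)" using x by (intro g)
    also have "\<dots> = (\<Sum>i\<in>{m}. G i x)"
    proof (rule sum.mono_neutral_right)
      show "\<forall>i\<in>{..m} - {m}. G i x = 0"
      proof
        fix i assume "i \<in> {..m} - {m}"
        then have "real i + 1 \<le> x \<bullet> x" using x by auto
        then show "G i x = 0" by (rule upp)
      qed
    qed auto
    finally show "g x = G m x" by simp
  qed
qed

section \<open>Lower derivates and the final decomposition\<close>

lemma Liminf_quotient_lower_bound:
  fixes f :: "'a::real_normed_vector \<Rightarrow> real"
  assumes "Liminf (at x within \<Omega>) (\<lambda>y. ereal ((f y - f x) / norm (y - x))) > -\<infinity>"
  obtains k :: nat where "\<And>y. y \<in> \<Omega> \<Longrightarrow> norm (y - x) < inverse (real (Suc k)) \<Longrightarrow> f x - real k * norm (y - x) \<le> f y"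
proof -
  obtain a where a: "ereal a < Liminf (at x within \<Omega>) (\<lambda>y. ereal ((f y - f x) / norm (y - x)))"
    using ereal_dense2[OF assms] by blast
  have "\<forall>\<^sub>F y in at x within \<Omega>. ereal a < ereal ((f y - f x) / norm (y - x))"
    using a by (rule less_LiminfD)
  then obtain d where d: "d > 0" "\<And>y. y \<in> \<Omega> \<Longrightarrow> y \<noteq> x \<Longrightarrow> norm (y - x) < d \<Longrightarrow> a < (f y - f x) / norm (y - x)"
    unfolding eventually_at by (auto simp: dist_norm)
  obtain i where i: "inverse (real (Suc i)) < d" using reals_Archimedean[OF d(1)] by blast
  obtain j where j: "\<bar>a\<bar> \<le> real j" using real_arch_simple by blast
  \<comment> \<open>One index serves as slope and as reciprocal scale. Enlarging it weakens both
    requirements, so the sets it defines increase with \<open>k\<close>.\<close>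
  define k where "k = max i j"
  have k: "inverse (real (Suc k)) \<le> inverse (real (Suc i))" "\<bar>a\<bar> \<le> real k" using j by (auto simp: k_def)
  show ?thesis
  proof (rule that)
    fix y assume y: "y \<in> \<Omega>" "norm (y - x) < inverse (real (Suc k))"
    show "f x - real k * norm (y - x) \<le> f y"
    proof (cases "y = x")
      case False
      moreover have "norm (y - x) < d" using y k i by linarith
      ultimately have "a < (f y - f x) / norm (y - x)" using y by (intro d(2))
      then have "a * norm (y - x) < f y - f x" using False by (simp add: field_simps)
      moreover have "- real k * norm (y - x) \<le> a * norm (y - x)" using k by (intro mult_right_mono) auto
      ultimately show ?thesis by simp
    qed simp
  qed
qed

text \<open>The Lipschitz bound for pairs closer than \<open>d\<close> gives uniform continuity and,
  \<open>E\<close> being bounded, a bound \<open>B\<close> of \<open>f\<close> on \<open>E\<close>.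
  Pairs at distance at least \<open>d\<close> are then covered by the slope
  \<open>2 * B / d\<close>.\<close>

lemma lipschitz_on_if_uniform_lower_bound:
  fixes f :: "'a::euclidean_space \<Rightarrow> real"
  assumes E: "bounded E" and low: "\<And>x y. x \<in> E \<Longrightarrow> y \<in> E \<Longrightarrow> norm (y - x) < d \<Longrightarrow> f x - K * norm (y - x) \<le> f y"
    and "0 < d" "0 \<le> K"
  obtains M where "M-lipschitz_on E f"
proof -
  have near: "\<bar>f x - f y\<bar> \<le> K * norm (x - y)" if "x \<in> E" "y \<in> E" "norm (x - y) < d" for x y
    using low[of x y] low[of y x] that by (simp add: norm_minus_commute abs_le_iff)
  have "uniformly_continuous_on E f"
    unfolding uniformly_continuous_on_def
  proof (intro allI impI)
    fix e :: real assume "0 < e"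
    have "dist (f y) (f x) < e" if "x \<in> E" "y \<in> E" "dist y x < min d (e / (K + 1))" for x y
    proof -
      have "\<bar>f y - f x\<bar> \<le> K * norm (y - x)" using that by (intro near) (auto simp: dist_norm)
      also have "\<dots> \<le> (K + 1) * norm (y - x)" by (simp add: mult_right_mono)
      also have "\<dots> < e" using that \<open>0 \<le> K\<close> by (simp add: dist_norm field_simps)
      finally show ?thesis by (simp add: dist_real_def)
    qed
    then show "\<exists>\<delta>>0. \<forall>x\<in>E. \<forall>y\<in>E. dist y x < \<delta> \<longrightarrow> dist (f y) (f x) < e"
      using \<open>0 < d\<close> \<open>0 < e\<close> \<open>0 \<le> K\<close> by (intro exI[of _ "min d (e / (K + 1))"]) auto
  qed
  then have "bounded (f ` E)" using E by (rule bounded_uniformly_continuous_image)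
  then obtain B where B: "0 < B" "\<And>x. x \<in> E \<Longrightarrow> \<bar>f x\<bar> \<le> B" unfolding bounded_pos by auto
  define M where "M = max K (2 * B / d)"
  have "M-lipschitz_on E f"
  proof (rule lipschitz_onI)
    fix x y assume xy: "x \<in> E" "y \<in> E"
    have "\<bar>f x - f y\<bar> \<le> M * norm (x - y)"
    proof (cases "norm (x - y) < d")
      case True
      then have "\<bar>f x - f y\<bar> \<le> K * norm (x - y)" using xy by (intro near)
      also have "\<dots> \<le> M * norm (x - y)" by (simp add: M_def mult_right_mono)
      finally show ?thesis .
    next
      case False
      have "\<bar>f x - f y\<bar> \<le> 2 * B" using B(2)[OF xy(1)] B(2)[OF xy(2)] by linarith
      also have "\<dots> = 2 * B / d * d" using \<open>0 < d\<close> by simp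
      also have "\<dots> \<le> M * norm (x - y)" using False B \<open>0 < d\<close> by (intro mult_mono) (auto simp: M_def le_max_iff_disj)
      finally show ?thesis .
    qed
    then show "dist (f x) (f y) \<le> M * dist x y" by (simp add: dist_norm)
  qed (use \<open>0 \<le> K\<close> in \<open>simp add: M_def\<close>)
  then show ?thesis by (rule that)
qed

theorem theorem1:
  fixes \<Omega> :: "'a::euclidean_space set" and f :: "'a \<Rightarrow> real"
  assumes "\<Omega> \<in> sets lebesgue"
    and "AE x in lebesgue. x \<in> \<Omega> \<longrightarrow>
           Liminf (at x within \<Omega>) (\<lambda>y. ereal ((f y - f x) / norm (y - x))) > -\<infinity>"
  shows "\<forall>\<epsilon>>0. \<exists>g. C1_UNIV g \<and> lebesgue_outer {x \<in> \<Omega>. f x \<noteq> g x} \<le> ennreal \<epsilon>"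
proof (intro allI impI)
  fix \<epsilon> :: real assume "0 < \<epsilon>"
  define \<Omega>' where "\<Omega>' = {x\<in>\<Omega>. Liminf (at x within \<Omega>) (\<lambda>y. ereal ((f y - f x) / norm (y - x))) > -\<infinity>}"
  have "\<Omega> - \<Omega>' = {x \<in> space lebesgue. \<not> (x \<in> \<Omega> \<longrightarrow> Liminf (at x within \<Omega>) (\<lambda>y. ereal ((f y - f x) / norm (y - x))) > -\<infinity>)}"
    by (auto simp: \<Omega>'_def)
  moreover have "negligible \<dots>"
    using assms(2) by (simp only: negligible_iff_null_sets completion.AE_iff_null_sets)
  ultimately have neg: "negligible (\<Omega> - \<Omega>')" by (simp only:)
  have "\<Omega>' = \<Omega> - (\<Omega> - \<Omega>')" by (auto simp: \<Omega>'_def)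
  then have \<Omega>': "\<Omega>' \<in> sets lebesgue"
    using assms(1) neg by (metis negligible_imp_sets sets.Diff)
  define E where "E = (\<lambda>k. {x\<in>\<Omega>'. \<forall>y\<in>\<Omega>. norm (y - x) < inverse (real (Suc k)) \<longrightarrow> f x - real k * norm (y - x) \<le> f y})"
  have E_cover: "\<exists>k. x \<in> E k" if x: "x \<in> \<Omega>'" for x
  proof -
    obtain k :: nat where "\<And>y. y \<in> \<Omega> \<Longrightarrow> norm (y - x) < inverse (real (Suc k)) \<Longrightarrow> f x - real k * norm (y - x) \<le> f y"
      using Liminf_quotient_lower_bound[of x \<Omega> f] x unfolding \<Omega>'_def by (metis (mono_tags, lifting) mem_Collect_eq)
    then show ?thesis using x unfolding E_def by blast
  qed
  have E_mono: "mono E"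
  proof (rule monoI, rule subsetI)
    fix k l :: nat and x assume "k \<le> l" and x: "x \<in> E k"
    have *: "inverse (real (Suc l)) \<le> inverse (real (Suc k))" using \<open>k \<le> l\<close> by simp
    show "x \<in> E l" unfolding E_def
    proof (intro CollectI conjI ballI impI)
      fix y assume y: "y \<in> \<Omega>" "norm (y - x) < inverse (real (Suc l))"
      then have "norm (y - x) < inverse (real (Suc k))" using * by linarith
      then have "f x - real k * norm (y - x) \<le> f y" using x y(1) unfolding E_def by blast
      moreover have "real k * norm (y - x) \<le> real l * norm (y - x)" using \<open>k \<le> l\<close> by (intro mult_right_mono) auto
      ultimately show "f x - real l * norm (y - x) \<le> f y" by linarith
    qed (use x in \<open>simp add: E_def\<close>)
  qed
  \<comment> \<open>\<open>f\<close> is lower semicontinuous at the points of \<open>\<Omega>'\<close>, so \<open>E k\<close> is relatively closed there; this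
    yields measurability although \<open>f\<close> is arbitrary.\<close>
  have E_closed: "E k = \<Omega>' \<inter> closure (E k)" for k
  proof (intro equalityI subsetI)
    fix x assume x: "x \<in> \<Omega>' \<inter> closure (E k)"
    then obtain X where X: "\<forall>n. X n \<in> E k" "X \<longlonglongrightarrow> x" by (auto simp: closure_sequential)
    have X\<Omega>: "X n \<in> \<Omega>" for n using X(1)[rule_format, of n] by (auto simp: E_def \<Omega>'_def)
    \<comment> \<open>The index \<open>j\<close> may be much larger than \<open>k\<close>: its error
      term \<open>real j * norm (X n - x)\<close> vanishes in the limit.\<close>
    obtain j where j: "x \<in> E j" using E_cover x by blast
    show "x \<in> E k" unfolding E_def
    proof (intro CollectI conjI ballI impI)
      fix y assume y: "y \<in> \<Omega>" "norm (y - x) < inverse (real (Suc k))"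
      have "((\<lambda>n. norm (y - X n)) \<longlonglongrightarrow> norm (y - x))" by (intro tendsto_intros X)
      then have ev1: "\<forall>\<^sub>F n in sequentially. norm (y - X n) < inverse (real (Suc k))"
        by (rule order_tendstoD) (rule y)
      have "((\<lambda>n. norm (X n - x)) \<longlonglongrightarrow> norm (x - x))" by (intro tendsto_intros X)
      then have ev2: "\<forall>\<^sub>F n in sequentially. norm (X n - x) < inverse (real (Suc j))"
        by (rule order_tendstoD) simp
      have "\<forall>\<^sub>F n in sequentially. f x - real j * norm (X n - x) - real k * norm (y - X n) \<le> f y"
        using ev1 ev2
      proof eventually_elim
        case (elim n)
        have "f (X n) - real k * norm (y - X n) \<le> f y" using X(1)[rule_format, of n] y(1) elim(1) unfolding E_def by blast
        moreover have "f x - real j * norm (X n - x) \<le> f (X n)" using j X\<Omega>[of n] elim(2) unfolding E_def by blast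
        ultimately show ?case by linarith
      qed
      moreover have "(\<lambda>n. f x - real j * norm (X n - x) - real k * norm (y - X n)) \<longlonglongrightarrow> f x - real j * norm (x - x) - real k * norm (y - x)"
        by (intro tendsto_intros X)
      ultimately have "f x - real j * norm (x - x) - real k * norm (y - x) \<le> f y"
        by (intro tendsto_upperbound) auto
      then show "f x - real k * norm (y - x) \<le> f y" by simp
    qed (use x in simp)
  next
    fix x assume "x \<in> E k"
    moreover have "E k \<subseteq> \<Omega>'" by (auto simp: E_def)
    ultimately show "x \<in> \<Omega>' \<inter> closure (E k)" using closure_subset by blast
  qed
  have E_meas: "E k \<in> sets lebesgue" for k
    by (subst E_closed) (intro sets.Int \<Omega>', simp)
  define shell where "shell = (\<lambda>m::nat. {x::'a. real m \<le> x \<bullet> x \<and> x \<bullet> x < real m + 1})"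
  have "\<exists>G B. C1_UNIV G \<and> (\<forall>x. x \<bullet> x \<le> real m \<longrightarrow> G x = 0) \<and> (\<forall>x. real m + 1 \<le> x \<bullet> x \<longrightarrow> G x = 0) \<and>
      B \<in> lmeasurable \<and> measure lebesgue B \<le> \<epsilon> * (1/2) ^ Suc m \<and> (\<forall>x\<in>\<Omega>' \<inter> shell m - B. f x = G x)" for m
  proof -
    \<comment> \<open>Half of the budget of the shell is for the part outside \<open>F k\<close>,
      half for the approximation of the Lipschitz function.\<close>
    define e where "e = \<epsilon> * (1/2) ^ Suc m / 2"
    have e: "0 < e" using \<open>0 < \<epsilon>\<close> by (simp add: e_def)
    have shell_b: "bounded {x::'a. x \<bullet> x \<le> real m + 1}"
    proof (rule bounded_subset[OF bounded_cball])
      show "{x::'a. x \<bullet> x \<le> real m + 1} \<subseteq> cball 0 (sqrt (real m + 1))"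
        by (auto simp: norm_eq_sqrt_inner)
    qed
    have shell_m: "shell m \<in> sets borel"
    proof -
      have "closed {x::'a. real m \<le> x \<bullet> x}" "open {x::'a. x \<bullet> x < real m + 1}"
        by (intro closed_Collect_le open_Collect_less continuous_intros)+
      moreover have "shell m = {x. real m \<le> x \<bullet> x} \<inter> {x. x \<bullet> x < real m + 1}" by (auto simp: shell_def)
      ultimately show ?thesis by auto
    qed
    let ?A = "\<Omega>' \<inter> shell m"
    have A: "?A \<in> lmeasurable"
    proof (rule bounded_set_imp_lmeasurable)
      show "bounded ?A" by (rule bounded_subset[OF shell_b]) (auto simp: shell_def)
    qed (use \<Omega>' shell_m in auto)
    \<comment> \<open>The layers removed on both sides of the shell make room for the cutoff, which
      is 1 on \<open>F k\<close>. Since \<open>k\<close> controls the layers as well as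
      \<open>E k\<close>, a single increasing sequence remains to be exhausted.\<close>
    define F where "F = (\<lambda>k. E k \<inter> {x. real m + inverse (real (Suc k)) \<le> x \<bullet> x \<and> x \<bullet> x \<le> real m + 1 - inverse (real (Suc k))})"
    have "closed {x::'a. real m + a \<le> x \<bullet> x \<and> x \<bullet> x \<le> real m + 1 - a}" for a
      by (intro closed_Collect_conj closed_Collect_le continuous_intros)
    then have F_meas: "F k \<in> sets lebesgue" for k
      unfolding F_def using E_meas by (intro sets.Int) auto
    have "mono F"
    proof (rule monoI)
      fix k l :: nat assume "k \<le> l"
      then have *: "inverse (real (Suc l)) \<le> inverse (real (Suc k))" "E k \<subseteq> E l" using monoD[OF E_mono] by auto
      show "F k \<subseteq> F l" unfolding F_def
      proof (intro subsetI IntI CollectI; elim IntE CollectE conjE)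
        fix x assume "real m + inverse (real (Suc k)) \<le> x \<bullet> x" "x \<bullet> x \<le> real m + 1 - inverse (real (Suc k))"
        then show "real m + inverse (real (Suc l)) \<le> x \<bullet> x \<and> x \<bullet> x \<le> real m + 1 - inverse (real (Suc l))"
          using *(1) by linarith
      qed (use * in blast)
    qed
    \<comment> \<open>Only the inner sphere is lost, since the half-open shell does not contain the
      outer one. For \<open>m = 0\<close> it is the origin.\<close>
    have "?A - (\<Union>k. F k) \<subseteq> sphere 0 (sqrt (real m))"
    proof
      fix x assume x: "x \<in> ?A - (\<Union>k. F k)"
      have "x \<bullet> x = real m"
      proof (rule ccontr)
        assume "x \<bullet> x \<noteq> real m"
        then have "0 < min (x \<bullet> x - real m) (real m + 1 - x \<bullet> x)" using x by (auto simp: shell_def)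
        then obtain i where i: "inverse (real (Suc i)) < min (x \<bullet> x - real m) (real m + 1 - x \<bullet> x)"
          using reals_Archimedean by blast
        obtain j where j: "x \<in> E j" using E_cover x by blast
        have "inverse (real (Suc (max i j))) \<le> inverse (real (Suc i))" by simp
        then have "real m + inverse (real (Suc (max i j))) \<le> x \<bullet> x" "x \<bullet> x \<le> real m + 1 - inverse (real (Suc (max i j)))"
          using i by linarith+
        moreover have "x \<in> E (max i j)" using j monoD[OF E_mono, of j "max i j"] by auto
        ultimately have "x \<in> F (max i j)" unfolding F_def by blast
        then show False using x by blast
      qed
      then show "x \<in> sphere 0 (sqrt (real m))" by (simp add: norm_eq_sqrt_inner)
    qed
    then have "negligible (?A - (\<Union>k. F k))" by (rule negligible_subset[OF negligible_sphere])
    from measure_Diff_exhaustion[OF A F_meas \<open>mono F\<close> this e]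
    obtain k where k: "?A - F k \<in> lmeasurable" "measure lebesgue (?A - F k) < e" .
    have bF: "bounded (F k)"
      by (rule bounded_subset[OF shell_b]) (auto simp: F_def intro: order_trans)
    have low: "f x - real k * norm (y - x) \<le> f y" if "x \<in> F k" "y \<in> F k" "norm (y - x) < inverse (real (Suc k))" for x y
      using that by (auto simp: F_def E_def \<Omega>'_def)
    obtain M where "M-lipschitz_on (F k) f"
      by (rule lipschitz_on_if_uniform_lower_bound[OF bF low]) auto
    then obtain H N where H: "C1_UNIV H" "N \<in> lmeasurable" "measure lebesgue N \<le> e" "\<And>x. x \<in> F k - N \<Longrightarrow> f x = H x"
      using lipschitz_on_bounded_C1[OF _ bF e] by metis
    have "0 < inverse (real (Suc k))" by simp
    from C1_shell_cutoff[OF this, of m]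
    obtain \<psi> :: "'a \<Rightarrow> real" where \<psi>: "C1_UNIV \<psi>" "\<And>x. x \<bullet> x \<le> real m \<Longrightarrow> \<psi> x = 0" "\<And>x. real m + 1 \<le> x \<bullet> x \<Longrightarrow> \<psi> x = 0"
      "\<And>x. real m + inverse (real (Suc k)) \<le> x \<bullet> x \<Longrightarrow> x \<bullet> x \<le> real m + 1 - inverse (real (Suc k)) \<Longrightarrow> \<psi> x = 1"
      by metis
    let ?B = "(?A - F k) \<union> N"
    have "measure lebesgue ?B \<le> measure lebesgue (?A - F k) + measure lebesgue N"
      using k H by (intro measure_Un_le) auto
    also have "\<dots> \<le> \<epsilon> * (1/2) ^ Suc m" using k H by (simp add: e_def)
    finally have "measure lebesgue ?B \<le> \<epsilon> * (1/2) ^ Suc m" .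
    moreover have "?B \<in> lmeasurable" using k H by (intro fmeasurable.Un)
    moreover have "C1_UNIV (\<lambda>x. \<psi> x * H x)" by (intro C1_UNIV_mult \<psi> H)
    moreover have "f x = \<psi> x * H x" if "x \<in> ?A - ?B" for x
    proof -
      have "x \<in> F k" "x \<notin> N" using that by auto
      then show ?thesis using \<psi>(4)[of x] H(4)[of x] by (simp add: F_def)
    qed
    ultimately show ?thesis using \<psi>(2,3) by (intro exI[of _ "\<lambda>x. \<psi> x * H x"] exI[of _ ?B]) auto
  qed
  then obtain G B where C1: "\<And>m. C1_UNIV (G m)"
    and G0: "\<And>m x. x \<bullet> x \<le> real m \<Longrightarrow> G m x = 0" "\<And>m x. real m + 1 \<le> x \<bullet> x \<Longrightarrow> G m x = 0"
    and B: "\<And>m. B m \<in> lmeasurable" "\<And>m. measure lebesgue (B m) \<le> \<epsilon> * (1/2) ^ Suc m"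
    and Gf: "\<And>m x. x \<in> \<Omega>' \<inter> shell m - B m \<Longrightarrow> f x = G m x"
    by metis
  have "\<exists>g. C1_UNIV g \<and> (\<forall>m x. real m \<le> x \<bullet> x \<longrightarrow> x \<bullet> x < real m + 1 \<longrightarrow> g x = G m x)"
    by (rule C1_glue_shells) (use C1 G0 in blast)+
  then obtain g where g: "C1_UNIV g" "\<And>m x. real m \<le> x \<bullet> x \<Longrightarrow> x \<bullet> x < real m + 1 \<Longrightarrow> g x = G m x"
    by auto
  have Bn: "measure lebesgue (\<Union>i\<le>n. B i) \<le> \<epsilon>" for n
    using B by (rule measure_geometric_UN_le[OF _ _ \<open>0 < \<epsilon>\<close>])
  have UB: "(\<Union>m. B m) \<in> lmeasurable" "measure lebesgue (\<Union>m. B m) \<le> \<epsilon>"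
    by (rule fmeasurable_countable_Union[OF B(1) Bn], rule measure_countable_Union_le[OF B(1) Bn])
  \<comment> \<open>A measurable cover of the disagreement set: the negligible bad points of
    \<open>\<Omega>\<close> and the exceptional sets of the shells. The outer measure is bounded
    through it.\<close>
  let ?B = "(\<Omega> - \<Omega>') \<union> (\<Union>m. B m)"
  have "{x \<in> \<Omega>. f x \<noteq> g x} \<subseteq> ?B"
  proof
    fix x assume x: "x \<in> {x \<in> \<Omega>. f x \<noteq> g x}"
    show "x \<in> ?B"
    proof (rule ccontr)
      assume nB: "x \<notin> ?B"
      let ?m = "nat \<lfloor>x \<bullet> x\<rfloor>"
      have m: "real ?m \<le> x \<bullet> x" "x \<bullet> x < real ?m + 1" by (simp_all add: of_nat_floor)
      then have "f x = G ?m x" using nB x by (intro Gf) (auto simp: shell_def)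
      then show False using g(2)[OF m] x by simp
    qed
  qed
  moreover have "?B \<in> sets lebesgue" using neg UB by (auto intro: negligible_imp_sets fmeasurableD)
  ultimately have "lebesgue_outer {x \<in> \<Omega>. f x \<noteq> g x} \<le> emeasure lebesgue ?B"
    unfolding lebesgue_outer_def by (intro INF_lower) auto
  also have "\<dots> \<le> emeasure lebesgue (\<Omega> - \<Omega>') + emeasure lebesgue (\<Union>m. B m)"
    using neg UB by (intro emeasure_subadditive) (auto intro: negligible_imp_sets fmeasurableD)
  also have "\<dots> = ennreal (measure lebesgue (\<Union>m. B m))"
  proof -
    have "emeasure lebesgue (\<Omega> - \<Omega>') = 0" using neg by (auto simp: negligible_iff_null_sets)
    then show ?thesis using UB(1) by (simp add: emeasure_eq_measure2)
  qed
  also have "\<dots> \<le> ennreal \<epsilon>" using UB(2) by (rule ennreal_leI)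
  finally show "\<exists>g. C1_UNIV g \<and> lebesgue_outer {x \<in> \<Omega>. f x \<noteq> g x} \<le> ennreal \<epsilon>" using g(1) by blast
qed

end
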